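(* Let $K=P_1\sqcup P_2$ (topological disjoint union), where $P_1$ and $P_2$ are locally compact Hausdorff spaces, $P_1$ belongs to class $\mathcal K_{\mathrm{IV}}$ and $P_2$ belongs to class $\mathcal K_{\mathrm{I}}$, $\mathcal K_{\mathrm{II}}$ or $\mathcal K_{\mathrm{III}}$. Let $F:C_0(K)\to C_0(K)$ be the operator of multiplication by the function equal to $1$ on $P_1$ and to $0$ on $P_2$. Then $F$ is adjointable, $F$ is not $C_0(K)$-compact, but the image under $F$ of the unit ball of $C_0(K)$ is $(C_b(K),C_0(K))$-totally bounded. Moreover, $C_0(K)$ has no frames (standard or non-standard).
   Context: Classes of locally compact Hausdorff spaces $P$ ($\sigma$-compact subset = countable union of compact subsets; precompact = having compact closure in $P$; $\alpha P$ = one-point compactification): $\mathcal K_{\mathrm I}$: $P$ is $\sigma$-compact. $\mathcal K_{\mathrm{II}}$: $P$ is not $\sigma$-compact but has a dense $\sigma$-compact subset. $\mathcal K_{\mathrm{III}}$: no $\sigma$-compact subset of $P$ is dense, and there exists a $\sigma$-compact subset that is not precompact. $\mathcal K_{\mathrm{IV}}$: for every $\sigma$-compact $S\subset P$ the complement $P\setminus S$ has nonempty interior in $P$ and the point at infinity is an interior point of $\alpha P\setminus S$; equivalently, $P$ is non-compact and every $\sigma$-compact subset of $P$ is precompact. $C_0(K)$ (continuous functions vanishing at infinity) is a Hilbert module over itself, and over its unitalization, with $\langle x,y\rangle=\overline{x}\,y$; $C_b(K)$ (bounded continuous functions) is its multiplier algebra and multiplier module. $\dot{\mathcal A}$ denotes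 the unitalization of a $C^*$-algebra $\mathcal A$ (equal to $\mathcal A$ if $\mathcal A$ is unital). $\mathcal A$-compactness: for Hilbert $\mathcal A$-modules $\mathcal M,\mathcal N$, elementary operators are $\theta_{x,y}(z)=x\langle y,z\rangle$ with $x\in\mathcal N$, $y\in\mathcal M$; the $\mathcal A$-compact operators $\mathcal M\to\mathcal N$ are the operator-norm closure of the linear span of these. $(C_b(K),C_0(K))$-total boundedness: a countable system $X=\{x_i\}\subset C_b(K)$ is (outer) $C_0(K)$-admissible if for every $x\in C_0(K)$ the series $\sum_i\langle x,x_i\rangle\langle x_i,x\rangle$ converges in norm, its sum is $\le\langle x,x\rangle$, and $\|x_i\|\le1$ for all $i$. For such $X$ and a countable collection $\Phi=\{\varphi_1,\varphi_2,\dots\}$ of states on $C_0(K)$ (positive linear functionals of norm $1$), put $d_{X,\Phi}(x,y)^2=\sup_k\sum_{i=k}^\infty|\varphi_k(\langle x-y,x_i\rangle)|^2$ for $x,y\in C_0(K)$. A set $Y\subset C_0(K)$ is $(C_b(K),C_0(K))$-totally bounded if for every such pair $(X,\Phi)$ and every $\varepsilon>0$ there are finitely many $y_1,\dots,y_n\in Y$ such that the sets $\{y\in Y: d_{X,\Phi}(y_i,y)<\varepsilon\}$ cover $Y$. Frames: let $\mathcal N$ be a Hilbert $C^*$-module over a unital $C^*$-algebra $\mathcal A$. A family $\{x_j\}_{j\in J}$ (any index set) in $\mathcal N$ is a standard frame if there are constants $c_1,c_2>0$ such that for every $x\in\mathcal N$ the series $\sum_j\langle x,x_j\rangle\langle x_j,x\rangle$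 converges in norm in $\mathcal A$ and $c_1\langle x,x\rangle\le\sum_j\langle x,x_j\rangle\langle x_j,x\rangle\le c_2\langle x,x\rangle$. It is a non-standard frame if the same holds with norm convergence replaced by convergence, in the ultraweak ($\sigma$-weak) topology, of the net of all finite partial sums to an element of the universal enveloping von Neumann algebra $\mathcal A''$ (the inequalities being understood in $\mathcal A''$). "Frame" means at least non-standard. For a Hilbert module over a non-unital $\mathcal A$, frames are understood by viewing it as a module over $\dot{\mathcal A}$. *)

theory Defs
  imports "HOL-Analysis.Analysis" "HOL-Library.Function_Algebras"
begin

section \<open>Classes of locally compact Hausdorff spaces\<close>

definition sigma_compactin :: "'a topology \<Rightarrow> 'a set \<Rightarrow> bool" where
  "sigma_compactin P S \<longleftrightarrow> (\<exists>C :: nat \<Rightarrow> 'a set. (\<forall>n. compactin P (C n)) \<and> S = (\<Union>n. C n))"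

definition precompactin :: "'a topology \<Rightarrow> 'a set \<Rightarrow> bool" where
  "precompactin P S \<longleftrightarrow> S \<subseteq> topspace P \<and> compactin P (P closure_of S)"

definition LCH_space :: "'a topology \<Rightarrow> bool" where
  "LCH_space P \<longleftrightarrow> locally_compact_space P \<and> Hausdorff_space P"

definition class_I :: "'a topology \<Rightarrow> bool" where
  "class_I P \<longleftrightarrow> LCH_space P \<and> sigma_compactin P (topspace P)"

definition class_II :: "'a topology \<Rightarrow> bool" where
  "class_II P \<longleftrightarrow> LCH_space P \<and> \<not> sigma_compactin P (topspace P) \<and>
     (\<exists>S. sigma_compactin P S \<and> P closure_of S = topspace P)"

definition class_III :: "'a topology \<Rightarrow> bool" where
  "class_III P \<longleftrightarrow> LCH_space P \<and>
     \<not> (\<exists>S. sigma_compactin P S \<and> P closure_of S = topspace P) \<and>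
     (\<exists>S. sigma_compactin P S \<and> \<not> precompactin P S)"

definition class_IV :: "'a topology \<Rightarrow> bool" where
  "class_IV P \<longleftrightarrow> LCH_space P \<and>
     (\<forall>S. sigma_compactin P S \<longrightarrow>
        P interior_of (topspace P - S) \<noteq> {} \<and>
        None \<in> Alexandroff_compactification P interior_of
                 (topspace (Alexandroff_compactification P) - Some ` S))"

section \<open>Function algebras\<close>

text \<open>A function on a space \<open>K\<close> is represented by the function on the whole type that is
  \<open>0\<close> outside \<^term>\<open>topspace K\<close>, so that equality of functions is HOL equality.  Sums,
  differences and products of functions are pointwise.\<close>

definition cont_fun :: "'k topology \<Rightarrow> ('k \<Rightarrow> complex) \<Rightarrow> bool" where
  "cont_fun K f \<longleftrightarrow> continuous_map K euclidean f \<and> (\<forall>t. t \<notin> topspace K \<longrightarrow> f t = 0)"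

definition Cb :: "'k topology \<Rightarrow> ('k \<Rightarrow> complex) set" where
  "Cb K = {f. cont_fun K f \<and> bounded (range f)}"

definition C0 :: "'k topology \<Rightarrow> ('k \<Rightarrow> complex) set" where
  "C0 K = {f. cont_fun K f \<and>
     (\<forall>e>0. \<exists>C. compactin K C \<and> (\<forall>t \<in> topspace K - C. cmod (f t) < e))}"

definition fscale :: "complex \<Rightarrow> ('k \<Rightarrow> complex) \<Rightarrow> 'k \<Rightarrow> complex" where
  "fscale c f = (\<lambda>t. c * f t)"

text \<open>The unit of \<^term>\<open>Cb K\<close> is the indicator function of \<^term>\<open>topspace K\<close>.  If \<open>K\<close> is
  compact, this function lies in \<^term>\<open>C0 K\<close> and nothing is added.\<close>

definition C0_unitization :: "'k topology \<Rightarrow> ('k \<Rightarrow> complex) set" where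
  "C0_unitization K = {f + fscale c (indicator (topspace K)) | f c. f \<in> C0 K}"

definition fnorm :: "('k \<Rightarrow> complex) \<Rightarrow> real" where
  "fnorm f = (SUP t. cmod (f t))"

definition norm_tendsto ::
    "('i \<Rightarrow> 'k \<Rightarrow> complex) \<Rightarrow> ('k \<Rightarrow> complex) \<Rightarrow> 'i filter \<Rightarrow> bool" where
  "norm_tendsto f s G \<longleftrightarrow> ((\<lambda>i. fnorm (f i - s)) \<longlongrightarrow> 0) G"

text \<open>\<open>\<langle>x, y\<rangle> = x\<^sup>* y\<close>: the inner product of a function algebra as a module over itself.\<close>

definition finner :: "('k \<Rightarrow> complex) \<Rightarrow> ('k \<Rightarrow> complex) \<Rightarrow> 'k \<Rightarrow> complex" where
  "finner x y = (\<lambda>t. cnj (x t) * y t)"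

text \<open>The order of the \<open>C\<^sup>*\<close>-algebra \<open>A\<close>: \<open>a \<le> b\<close> iff \<open>b - a = c\<^sup>* c\<close> for some \<open>c\<close> in \<open>A\<close>.\<close>

definition alg_le :: "('k \<Rightarrow> complex) set \<Rightarrow> ('k \<Rightarrow> complex) \<Rightarrow> ('k \<Rightarrow> complex) \<Rightarrow> bool" where
  "alg_le A a b \<longleftrightarrow> (\<exists>c\<in>A. b - a = finner c c)"

definition states :: "('k \<Rightarrow> complex) set \<Rightarrow> (('k \<Rightarrow> complex) \<Rightarrow> complex) set" where
  "states A = {\<phi> \<in> extensional A.
     (\<forall>a\<in>A. \<forall>b\<in>A. \<phi> (a + b) = \<phi> a + \<phi> b) \<and>
     (\<forall>a\<in>A. \<forall>c. \<phi> (fscale c a) = c * \<phi> a) \<and>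
     (\<forall>a\<in>A. \<phi> (finner a a) \<in> \<real>\<^sub>\<ge>\<^sub>0) \<and>
     bdd_above ((\<lambda>a. cmod (\<phi> a)) ` {a \<in> A. fnorm a \<le> 1}) \<and>
     (SUP a \<in> {a \<in> A. fnorm a \<le> 1}. cmod (\<phi> a)) = 1}"

section \<open>Adjointable and compact operators\<close>

definition adjointable ::
    "'m set \<Rightarrow> ('m \<Rightarrow> 'm \<Rightarrow> 'k \<Rightarrow> complex) \<Rightarrow> 'n set \<Rightarrow> ('n \<Rightarrow> 'n \<Rightarrow> 'k \<Rightarrow> complex) \<Rightarrow>
     ('m \<Rightarrow> 'n) \<Rightarrow> bool" where
  "adjointable M ipM N ipN T \<longleftrightarrow> T \<in> M \<rightarrow> N \<and>
     (\<exists>T' \<in> N \<rightarrow> M. \<forall>x\<in>M. \<forall>y\<in>N. ipN (T x) y = ipM x (T' y))"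

text \<open>Compact operators between Hilbert modules \<open>M\<close> and \<open>N\<close> consisting of functions, with the
  inner product \<^const>\<open>finner\<close> and pointwise module action.  The operator-norm distance to the
  linear span of the elementary operators has to be \<open>0\<close>.\<close>

definition elementary_op ::
    "('k \<Rightarrow> complex) \<Rightarrow> ('k \<Rightarrow> complex) \<Rightarrow> ('k \<Rightarrow> complex) \<Rightarrow> 'k \<Rightarrow> complex" where
  "elementary_op x y z = x * finner y z"

definition elementary_span ::
    "('k \<Rightarrow> complex) set \<Rightarrow> ('k \<Rightarrow> complex) set \<Rightarrow> (('k \<Rightarrow> complex) \<Rightarrow> 'k \<Rightarrow> complex) set" where
  "elementary_span M N =
     {S. \<exists>(n::nat) c x y. (\<forall>i<n. x i \<in> N \<and> y i \<in> M) \<and>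
           S = (\<lambda>z. \<Sum>i<n. fscale (c i) (elementary_op (x i) (y i) z))}"

definition module_compact ::
    "('k \<Rightarrow> complex) set \<Rightarrow> ('k \<Rightarrow> complex) set \<Rightarrow> (('k \<Rightarrow> complex) \<Rightarrow> 'k \<Rightarrow> complex) \<Rightarrow> bool" where
  "module_compact M N T \<longleftrightarrow> T \<in> M \<rightarrow> N \<and>
     (\<forall>e>0. \<exists>S \<in> elementary_span M N. \<forall>z\<in>M. fnorm (T z - S z) \<le> e * fnorm z)"

section \<open>Total boundedness\<close>

text \<open>Countable systems are indexed by \<^typ>\<open>nat\<close>: a finite system of functions may be padded
  with zeros, and a finite collection of states by repeating its last member; neither changes
  the value of \<open>dXP\<close> below.\<close>

definition outer_admissible :: "'k topology \<Rightarrow> (nat \<Rightarrow> 'k \<Rightarrow> complex) \<Rightarrow> bool" where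
  "outer_admissible K X \<longleftrightarrow> (\<forall>i. X i \<in> Cb K \<and> fnorm (X i) \<le> 1) \<and>
     (\<forall>x \<in> C0 K. \<exists>s \<in> C0 K.
        norm_tendsto (\<lambda>n. \<Sum>i<n. finner x (X i) * finner (X i) x) s sequentially \<and>
        alg_le (C0 K) s (finner x x))"

definition dXP ::
    "(nat \<Rightarrow> 'k \<Rightarrow> complex) \<Rightarrow> (nat \<Rightarrow> ('k \<Rightarrow> complex) \<Rightarrow> complex) \<Rightarrow>
     ('k \<Rightarrow> complex) \<Rightarrow> ('k \<Rightarrow> complex) \<Rightarrow> real" where
  "dXP X \<Phi> x y = sqrt (SUP k. \<Sum>i. (cmod (\<Phi> k (finner (x - y) (X (k + i)))))\<^sup>2)"

definition Cb_C0_totally_bounded :: "'k topology \<Rightarrow> ('k \<Rightarrow> complex) set \<Rightarrow> bool" where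
  "Cb_C0_totally_bounded K Y \<longleftrightarrow>
     (\<forall>X \<Phi>. outer_admissible K X \<and> (\<forall>k. \<Phi> k \<in> states (C0 K)) \<longrightarrow>
        (\<forall>e>0. \<exists>Z. finite Z \<and> Z \<subseteq> Y \<and> Y \<subseteq> (\<Union>z\<in>Z. {y \<in> Y. dXP X \<Phi> z y < e})))"

section \<open>The universal representation\<close>

text \<open>The universal representation of \<open>A\<close> is the direct sum of the GNS representations of all
  states of \<open>A\<close>.  Its Hilbert space is built in one step: on the algebraic direct sum of copies
  of \<open>A\<close> indexed by the states (finitely supported families) consider the positive semidefinite
  form given by \<open>\<langle>a, b\<rangle> = \<phi>(a\<^sup>* b)\<close> on the summand with index \<open>\<phi>\<close>; the space \<open>univ_space A\<close>
  consists of the Cauchy sequences for this form modulo null sequences.  Inner products are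
  conjugate linear in the first argument.\<close>

type_synonym 'k family = "(('k \<Rightarrow> complex) \<Rightarrow> complex) \<Rightarrow> 'k \<Rightarrow> complex"
type_synonym 'k uvec = "(nat \<Rightarrow> 'k family) set"

definition univ_pre :: "('k \<Rightarrow> complex) set \<Rightarrow> 'k family set" where
  "univ_pre A = {u. (\<forall>\<phi>. u \<phi> \<in> A) \<and> finite {\<phi>. u \<phi> \<noteq> 0} \<and> {\<phi>. u \<phi> \<noteq> 0} \<subseteq> states A}"

definition univ_form :: "'k family \<Rightarrow> 'k family \<Rightarrow> complex" where
  "univ_form u v = (\<Sum>\<phi> | u \<phi> \<noteq> 0 \<and> v \<phi> \<noteq> 0. \<phi> (finner (u \<phi>) (v \<phi>)))"

definition univ_seminorm :: "'k family \<Rightarrow> real" where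
  "univ_seminorm u = sqrt (Re (univ_form u u))"

definition univ_cauchy :: "('k \<Rightarrow> complex) set \<Rightarrow> (nat \<Rightarrow> 'k family) set" where
  "univ_cauchy A = {u. (\<forall>n. u n \<in> univ_pre A) \<and>
     (\<forall>e>0. \<exists>N. \<forall>m\<ge>N. \<forall>n\<ge>N. univ_seminorm (u m - u n) < e)}"

definition univ_rel :: "('k \<Rightarrow> complex) set \<Rightarrow> ((nat \<Rightarrow> 'k family) \<times> (nat \<Rightarrow> 'k family)) set" where
  "univ_rel A = {(u, v). u \<in> univ_cauchy A \<and> v \<in> univ_cauchy A \<and>
     (\<lambda>n. univ_seminorm (u n - v n)) \<longlonglongrightarrow> 0}"

definition univ_space :: "('k \<Rightarrow> complex) set \<Rightarrow> 'k uvec set" where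
  "univ_space A = univ_cauchy A // univ_rel A"

definition univ_add :: "('k \<Rightarrow> complex) set \<Rightarrow> 'k uvec \<Rightarrow> 'k uvec \<Rightarrow> 'k uvec" where
  "univ_add A \<xi> \<eta> = (\<Union>u\<in>\<xi>. \<Union>v\<in>\<eta>. univ_rel A `` {u + v})"

definition univ_scale :: "('k \<Rightarrow> complex) set \<Rightarrow> complex \<Rightarrow> 'k uvec \<Rightarrow> 'k uvec" where
  "univ_scale A c \<xi> = (\<Union>u\<in>\<xi>. univ_rel A `` {\<lambda>n \<phi>. fscale c (u n \<phi>)})"

definition univ_inner :: "'k uvec \<Rightarrow> 'k uvec \<Rightarrow> complex" where
  "univ_inner \<xi> \<eta> = (THE c. \<forall>u\<in>\<xi>. \<forall>v\<in>\<eta>. (\<lambda>n. univ_form (u n) (v n)) \<longlonglongrightarrow> c)"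

definition univ_norm :: "'k uvec \<Rightarrow> real" where
  "univ_norm \<xi> = sqrt (Re (univ_inner \<xi> \<xi>))"

definition univ_rep :: "('k \<Rightarrow> complex) set \<Rightarrow> ('k \<Rightarrow> complex) \<Rightarrow> 'k uvec \<Rightarrow> 'k uvec" where
  "univ_rep A a \<xi> = (\<Union>u\<in>\<xi>. univ_rel A `` {\<lambda>n \<phi>. a * u n \<phi>})"

section \<open>The universal enveloping von Neumann algebra\<close>

text \<open>Operators on \<^term>\<open>univ_space A\<close> are HOL functions of which only the values on
  \<^term>\<open>univ_space A\<close> matter.\<close>

definition univ_bounded_op :: "('k \<Rightarrow> complex) set \<Rightarrow> ('k uvec \<Rightarrow> 'k uvec) \<Rightarrow> bool" where
  "univ_bounded_op A T \<longleftrightarrow> T \<in> univ_space A \<rightarrow> univ_space A \<and>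
     (\<forall>\<xi>\<in>univ_space A. \<forall>\<eta>\<in>univ_space A. T (univ_add A \<xi> \<eta>) = univ_add A (T \<xi>) (T \<eta>)) \<and>
     (\<forall>\<xi>\<in>univ_space A. \<forall>c. T (univ_scale A c \<xi>) = univ_scale A c (T \<xi>)) \<and>
     (\<exists>C. \<forall>\<xi>\<in>univ_space A. univ_norm (T \<xi>) \<le> C * univ_norm \<xi>)"

definition univ_commutant ::
    "('k \<Rightarrow> complex) set \<Rightarrow> ('k uvec \<Rightarrow> 'k uvec) set \<Rightarrow> ('k uvec \<Rightarrow> 'k uvec) set" where
  "univ_commutant A \<S> = {T. univ_bounded_op A T \<and>
     (\<forall>S\<in>\<S>. \<forall>\<xi>\<in>univ_space A. T (S \<xi>) = S (T \<xi>))}"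

definition enveloping_vN :: "('k \<Rightarrow> complex) set \<Rightarrow> ('k uvec \<Rightarrow> 'k uvec) set" where
  "enveloping_vN A = univ_commutant A (univ_commutant A (univ_rep A ` A))"

text \<open>The ultraweak topology is given by the functionals
  \<open>T \<mapsto> \<Sum>n. \<langle>\<eta> n, T (\<xi> n)\<rangle>\<close> for square-summable sequences \<open>\<xi>\<close> and \<open>\<eta>\<close> of vectors.\<close>

definition ultraweak_tendsto ::
    "('k \<Rightarrow> complex) set \<Rightarrow> ('i \<Rightarrow> 'k uvec \<Rightarrow> 'k uvec) \<Rightarrow> ('k uvec \<Rightarrow> 'k uvec) \<Rightarrow> 'i filter \<Rightarrow> bool" where
  "ultraweak_tendsto A S T G \<longleftrightarrow>
     (\<forall>\<xi> \<eta> :: nat \<Rightarrow> 'k uvec. range \<xi> \<subseteq> univ_space A \<and> range \<eta> \<subseteq> univ_space A \<and>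
        summable (\<lambda>n. (univ_norm (\<xi> n))\<^sup>2) \<and> summable (\<lambda>n. (univ_norm (\<eta> n))\<^sup>2) \<longrightarrow>
        ((\<lambda>i. \<Sum>n. univ_inner (\<eta> n) (S i (\<xi> n))) \<longlongrightarrow> (\<Sum>n. univ_inner (\<eta> n) (T (\<xi> n)))) G)"

text \<open>\<open>S \<le> T\<close> iff \<open>T - S\<close> is a positive operator.\<close>

definition univ_op_le ::
    "('k \<Rightarrow> complex) set \<Rightarrow> ('k uvec \<Rightarrow> 'k uvec) \<Rightarrow> ('k uvec \<Rightarrow> 'k uvec) \<Rightarrow> bool" where
  "univ_op_le A S T \<longleftrightarrow>
     (\<forall>\<xi>\<in>univ_space A. univ_inner \<xi> (T \<xi>) - univ_inner \<xi> (S \<xi>) \<in> \<real>\<^sub>\<ge>\<^sub>0)"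

section \<open>Frames\<close>

text \<open>\<open>A\<close> is a unital algebra of functions, and \<open>N\<close> a Hilbert module over \<open>A\<close> with inner
  product \<open>ip\<close>.  Convergence of a series indexed by the set \<open>J\<close> refers to the net of its finite
  partial sums.\<close>

definition frame_sum ::
    "('n \<Rightarrow> 'n \<Rightarrow> 'k \<Rightarrow> complex) \<Rightarrow> ('j \<Rightarrow> 'n) \<Rightarrow> 'n \<Rightarrow> 'j set \<Rightarrow> 'k \<Rightarrow> complex" where
  "frame_sum ip xs x F = (\<Sum>j\<in>F. ip x (xs j) * ip (xs j) x)"

definition standard_frame ::
    "('k \<Rightarrow> complex) set \<Rightarrow> 'n set \<Rightarrow> ('n \<Rightarrow> 'n \<Rightarrow> 'k \<Rightarrow> complex) \<Rightarrow> 'j set \<Rightarrow> ('j \<Rightarrow> 'n) \<Rightarrow> bool" where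
  "standard_frame A N ip J xs \<longleftrightarrow> (\<forall>j\<in>J. xs j \<in> N) \<and>
     (\<exists>c1 c2 :: real. c1 > 0 \<and> c2 > 0 \<and>
        (\<forall>x\<in>N. \<exists>s\<in>A. norm_tendsto (frame_sum ip xs x) s (finite_subsets_at_top J) \<and>
           alg_le A (fscale (of_real c1) (ip x x)) s \<and>
           alg_le A s (fscale (of_real c2) (ip x x))))"

definition nonstandard_frame ::
    "('k \<Rightarrow> complex) set \<Rightarrow> 'n set \<Rightarrow> ('n \<Rightarrow> 'n \<Rightarrow> 'k \<Rightarrow> complex) \<Rightarrow> 'j set \<Rightarrow> ('j \<Rightarrow> 'n) \<Rightarrow> bool" where
  "nonstandard_frame A N ip J xs \<longleftrightarrow> (\<forall>j\<in>J. xs j \<in> N) \<and>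
     (\<exists>c1 c2 :: real. c1 > 0 \<and> c2 > 0 \<and>
        (\<forall>x\<in>N. \<exists>T \<in> enveloping_vN A.
           ultraweak_tendsto A (\<lambda>F. univ_rep A (frame_sum ip xs x F)) T (finite_subsets_at_top J) \<and>
           univ_op_le A (univ_rep A (fscale (of_real c1) (ip x x))) T \<and>
           univ_op_le A T (univ_rep A (fscale (of_real c2) (ip x x)))))"

end

theory Submission
  imports Defs
begin

text \<open>Every state of \<open>C\<^sub>0(K)\<close> is carried by a \<open>\<sigma>\<close>-compact set, so on functions supported in
  \<open>P\<^sub>1\<close> countably many states only see one compact subset of \<open>P\<^sub>1\<close>.  There the tails of an
  admissible system are uniformly small, and what remains of the pseudometric involves finitely
  many bounded functionals.  In contrast, a compact operator on \<open>C\<^sub>0(K)\<close> is nearly multiplication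
  by a function vanishing at infinity, which \<open>F\<close> is not, as \<open>P\<^sub>1\<close> is not compact.

  For a frame \<open>x\<^sub>j\<close>, evaluation at a point \<open>t\<close> is a vector state of the universal representation,
  so \<open>\<Sum>\<^sub>j |x\<^sub>j(t)|\<^sup>2\<close> converges to a positive number even if the frame is non-standard: at each
  point some \<open>x\<^sub>j\<close> is nonzero, but only countably many are.  This is impossible on \<open>P\<^sub>1\<close>.\<close>

section \<open>Continuous functions on a space\<close>

text \<open>Admissibility makes the tails of the sum of |X_i|^2 uniformly small only after
  multiplication by an element of \<open>C0 K\<close>; on K itself they need not be small at all.
  The states are therefore confined to one compact set before anything is estimated, and a bump
  function equal to 1 on that set replaces each X_i by an element of \<open>C0 K\<close>. The
  supremum over k in the pseudometric causes no trouble because the k-th sum starts at i = k: for k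
  at least N it is a tail, and the remaining terms involve only the functionals with k, i < N. The
  index set of a frame is arbitrary, and countability holds only at each point separately. The
  supports of all frame elements thus cannot be enclosed in one compact set at a stroke, and the
  contradiction has to be built point by point.\<close>

lemma finner_apply [simp]: "finner x y t = cnj (x t) * y t"
  by (simp add: finner_def)

lemma fscale_apply [simp]: "fscale c f t = c * f t"
  by (simp add: fscale_def)

lemma sum_fun_apply [simp]: "(\<Sum>i\<in>I. f i) t = (\<Sum>i\<in>I. f i t)"
  by (induction I rule: infinite_finite_induct) auto

lemma continuous_map_comp2:
  fixes f :: "'a \<Rightarrow> 'b :: topological_space" and g :: "'a \<Rightarrow> 'c :: topological_space"
  assumes "continuous_map K euclidean f" "continuous_map K euclidean g"
    and "continuous_on UNIV (\<lambda>p. h (fst p) (snd p))"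
  shows "continuous_map K euclidean (\<lambda>t. h (f t) (g t))"
proof -
  have 1: "continuous_map K euclidean (\<lambda>t. (f t, g t))"
    using assms(1,2) continuous_map_pairwise[of K euclidean euclidean "\<lambda>t. (f t, g t)"]
    by (simp add: o_def flip: euclidean_product_topology)
  have 2: "continuous_map euclidean euclidean (\<lambda>p. h (fst p) (snd p))"
    using assms(3) by simp
  show ?thesis
    using continuous_map_compose[OF 1 2] by (simp add: o_def)
qed

lemma cont_fun_comp2:
  assumes "cont_fun K f" "cont_fun K g" "continuous_on UNIV (\<lambda>p. h (fst p) (snd p))" "h 0 0 = 0"
  shows "cont_fun K (\<lambda>t. h (f t) (g t))"
  using assms continuous_map_comp2[of K f g h] by (simp add: cont_fun_def)

lemma continuous_on_complex_pair:
  "continuous_on UNIV (\<lambda>p :: complex \<times> complex. fst p + snd p)"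
  "continuous_on UNIV (\<lambda>p :: complex \<times> complex. fst p - snd p)"
  "continuous_on UNIV (\<lambda>p :: complex \<times> complex. fst p * snd p)"
  "continuous_on UNIV (\<lambda>p :: complex \<times> complex. c * fst p)"
  "continuous_on UNIV (\<lambda>p :: complex \<times> complex. cnj (fst p))"
  by (intro continuous_intros)+

lemma cont_fun_mult:
  assumes "cont_fun K f" "cont_fun K g"
  shows "cont_fun K (f * g)"
  using cont_fun_comp2[OF assms, of "(*)"] by (simp add: times_fun_def continuous_on_complex_pair)

lemma cont_fun_indicator:
  assumes "openin K A" "closedin K A"
  shows "cont_fun K (indicator A)"
proof -
  have "openin K {t \<in> topspace K. indicator A t \<in> (U :: complex set)}" for U
  proof -
    have "{t \<in> topspace K. indicator A t \<in> U} =
        (if 1 \<in> U then A else {}) \<union> (if 0 \<in> U then topspace K - A else {})"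
      using openin_subset[OF assms(1)] by (auto simp: indicator_def split: if_splits)
    then show ?thesis
      using assms by auto
  qed
  then show ?thesis
    using openin_subset[OF assms(1)] by (auto simp: cont_fun_def continuous_map_def indicator_def)
qed

lemma openin_nonzero:
  assumes "cont_fun K f"
  shows "openin K {t \<in> topspace K. f t \<noteq> 0}"
  using assms openin_continuous_map_preimage[of K euclidean f "- {0}"]
  by (auto simp: cont_fun_def)

section \<open>Functions vanishing at infinity: closure properties\<close>

lemma C0_small_outside:
  assumes "f \<in> C0 K" "e > 0"
  obtains C where "compactin K C" "\<And>t. t \<in> topspace K - C \<Longrightarrow> cmod (f t) < e"
  using assms unfolding C0_def by blast

text \<open>Continuity of \<open>h\<close> at the origin is what makes \<open>h (f t) (g t)\<close>
  small wherever both \<open>f t\<close> and \<open>g t\<close> are. Sums, differences, scalar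
  multiples and conjugates are all instances; for one-argument operations \<open>h\<close> ignores
  its second argument.\<close>

lemma C0_comp2:
  assumes "f \<in> C0 K" "g \<in> C0 K" "continuous_on UNIV (\<lambda>p. h (fst p) (snd p))" "h 0 0 = 0"
  shows "(\<lambda>t. h (f t) (g t)) \<in> C0 K"
  unfolding C0_def mem_Collect_eq
proof (intro conjI allI impI)
  show "cont_fun K (\<lambda>t. h (f t) (g t))"
    using assms(1,2) cont_fun_comp2[of K f g h, OF _ _ assms(3,4)] by (simp add: C0_def)
  fix e :: real assume "e > 0"
  have "isCont (\<lambda>p. h (fst p) (snd p)) (0, 0)"
    using assms(3) by (simp add: continuous_on_eq_continuous_at)
  then obtain d where d: "d > 0" "\<And>p. dist p (0, 0) < d \<Longrightarrow>
      dist (h (fst p) (snd p)) (h (fst (0 :: complex, 0 :: complex)) (snd (0 :: complex, 0 :: complex))) < e"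
    using \<open>e > 0\<close> unfolding continuous_at_eps_delta by meson
  have hd: "cmod (h z w) < e" if "cmod z < d/2" "cmod w < d/2" for z w
  proof -
    have "dist (z, w) (0, 0) = norm (z, w)"
      by (simp add: dist_norm)
    also have "\<dots> \<le> norm z + norm w"
      by (rule norm_Pair_le)
    also have "\<dots> < d"
      using that by simp
    finally show ?thesis
      using d(2)[of "(z, w)"] assms(4) by simp
  qed
  obtain C where C: "compactin K C" "\<And>t. t \<in> topspace K - C \<Longrightarrow> cmod (f t) < d/2"
    using C0_small_outside[OF assms(1) half_gt_zero[OF d(1)]] by blast
  obtain D where D: "compactin K D" "\<And>t. t \<in> topspace K - D \<Longrightarrow> cmod (g t) < d/2"
    using C0_small_outside[OF assms(2) half_gt_zero[OF d(1)]] by blast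
  show "\<exists>C. compactin K C \<and> (\<forall>t\<in>topspace K - C. cmod (h (f t) (g t)) < e)"
    by (intro exI[of _ "C \<union> D"] conjI ballI compactin_Un C D hd) auto
qed

lemma C0_add: "f \<in> C0 K \<Longrightarrow> g \<in> C0 K \<Longrightarrow> f + g \<in> C0 K"
  using C0_comp2[of f K g "(+)"] by (simp add: plus_fun_def continuous_on_complex_pair)

lemma C0_fscale: "f \<in> C0 K \<Longrightarrow> fscale c f \<in> C0 K"
  using C0_comp2[of f K f "\<lambda>z w. c * z"] by (simp add: fscale_def continuous_on_complex_pair)

lemma C0_diff: "f \<in> C0 K \<Longrightarrow> g \<in> C0 K \<Longrightarrow> f - g \<in> C0 K"
  using C0_comp2[of f K g "(-)"] by (simp add: fun_diff_def continuous_on_complex_pair)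

lemma C0_zero: "0 \<in> C0 K"
  by (auto simp: C0_def cont_fun_def zero_fun_def intro!: exI[of _ "{}"])

lemma C0_sum: "(\<And>i. i \<in> I \<Longrightarrow> f i \<in> C0 K) \<Longrightarrow> (\<Sum>i\<in>I. f i) \<in> C0 K"
  by (induction I rule: infinite_finite_induct) (auto intro: C0_add C0_zero)

lemma C0_subset_Cb: "C0 K \<subseteq> Cb K"
proof
  fix f assume f: "f \<in> C0 K"
  then obtain C where C: "compactin K C" "\<And>t. t \<in> topspace K - C \<Longrightarrow> cmod (f t) < 1"
    using C0_small_outside[OF f zero_less_one] by blast
  have "continuous_map K euclidean f"
    using f by (simp add: C0_def cont_fun_def)
  from image_compactin[OF C(1) this] have "bounded (f ` C)"
    by (simp add: compact_imp_bounded)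
  then obtain B where B: "\<And>t. t \<in> C \<Longrightarrow> cmod (f t) \<le> B"
    by (auto simp: bounded_iff)
  have "cmod (f t) \<le> max B 1" for t
  proof (cases "t \<in> topspace K")
    case True
    then show ?thesis using B[of t] C(2)[of t] by (cases "t \<in> C") auto
  next
    case False
    then show ?thesis using f by (auto simp: C0_def cont_fun_def)
  qed
  then show "f \<in> Cb K"
    using f by (auto simp: Cb_def C0_def bounded_iff)
qed

lemma C0_imp_Cb: "f \<in> C0 K \<Longrightarrow> f \<in> Cb K"
  using C0_subset_Cb by blast

lemma C0_mult_Cb:
  assumes "f \<in> C0 K" "g \<in> Cb K"
  shows "f * g \<in> C0 K"
  unfolding C0_def mem_Collect_eq
proof (intro conjI allI impI)
  show "cont_fun K (f * g)"
    using assms by (intro cont_fun_mult) (auto simp: C0_def Cb_def)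
  fix e :: real assume "e > 0"
  obtain B where B: "B > 0" "\<And>t. cmod (g t) \<le> B"
    using assms(2) by (auto simp: Cb_def bounded_pos)
  obtain C where C: "compactin K C" "\<And>t. t \<in> topspace K - C \<Longrightarrow> cmod (f t) < e / B"
    using C0_small_outside[OF assms(1) divide_pos_pos[OF \<open>e > 0\<close> B(1)]] by blast
  have "cmod ((f * g) t) < e" if "t \<in> topspace K - C" for t
  proof -
    have "cmod ((f * g) t) \<le> cmod (f t) * B"
      using B by (simp add: norm_mult mult_left_mono)
    also have "\<dots> < e"
      using C(2)[OF that] B(1) by (simp add: field_simps)
    finally show ?thesis .
  qed
  then show "\<exists>C. compactin K C \<and> (\<forall>t\<in>topspace K - C. cmod ((f * g) t) < e)"
    using C(1) by blast
qed

lemma Cb_cnj: "f \<in> Cb K \<Longrightarrow> (\<lambda>t. cnj (f t)) \<in> Cb K"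
  using cont_fun_comp2[of K f f "\<lambda>z w. cnj z"]
  by (simp add: Cb_def bounded_iff continuous_on_complex_pair)

lemma finner_C0_left:
  assumes "f \<in> C0 K" "g \<in> Cb K"
  shows "finner f g \<in> C0 K"
proof -
  have "(\<lambda>t. cnj (f t)) \<in> C0 K"
    using C0_comp2[of f K f "\<lambda>z w. cnj z"] assms(1) by (simp add: continuous_on_complex_pair)
  from C0_mult_Cb[OF this assms(2)] show ?thesis
    by (simp add: finner_def times_fun_def)
qed

lemma finner_C0_right:
  assumes "f \<in> Cb K" "g \<in> C0 K"
  shows "finner f g \<in> C0 K"
  using C0_mult_Cb[OF assms(2) Cb_cnj[OF assms(1)]]
  by (simp add: finner_def times_fun_def mult.commute)

lemma C0_mult: "f \<in> C0 K \<Longrightarrow> g \<in> C0 K \<Longrightarrow> f * g \<in> C0 K"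
  using C0_mult_Cb C0_subset_Cb by blast

section \<open>Supremum norm, supports and bump functions\<close>

lemma cmod_le_fnorm:
  assumes "bounded (range f)"
  shows "cmod (f t) \<le> fnorm f"
proof -
  obtain B where "\<And>t. cmod (f t) \<le> B"
    using assms by (auto simp: bounded_iff)
  then show ?thesis
    unfolding fnorm_def by (intro cSUP_upper bdd_aboveI2) auto
qed

lemma fnorm_le: "(\<And>t. cmod (f t) \<le> c) \<Longrightarrow> fnorm f \<le> c"
  unfolding fnorm_def by (intro cSUP_least) auto

lemma C0_bounded: "f \<in> C0 K \<Longrightarrow> bounded (range f)"
  using C0_subset_Cb by (auto simp: Cb_def)

text \<open>\<open>fnorm\<close> is a real supremum and bounds the values of a function only if that
  function is bounded, hence the second hypothesis.\<close>

lemma norm_tendsto_apply: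
  assumes "norm_tendsto f s G" "\<forall>\<^sub>F i in G. bounded (range (f i - s))"
  shows "((\<lambda>i. f i t) \<longlongrightarrow> s t) G"
proof -
  have "\<forall>\<^sub>F i in G. norm (f i t - s t) \<le> fnorm (f i - s)"
    using assms(2) by eventually_elim (use cmod_le_fnorm in fastforce)
  then have "((\<lambda>i. f i t - s t) \<longlongrightarrow> 0) G"
    using assms(1) unfolding norm_tendsto_def by (rule Lim_null_comparison)
  then show ?thesis
    by (simp add: LIM_zero_iff)
qed

text \<open>The compact sets outside which |f| < 1/(n+1) exhaust the nonzero set of
  \<open>f\<close>; intersecting them with the closed set \<open>A\<close> keeps them
  compact.\<close>

lemma C0_nonzero_sigma_compact:
  assumes "f \<in> C0 K" "closedin K A"
  shows "\<exists>C :: nat \<Rightarrow> 'a set. (\<forall>n. compactin K (C n) \<and> C n \<subseteq> A) \<and>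
    {t \<in> A. f t \<noteq> 0} \<subseteq> (\<Union>n. C n)"
proof -
  have "\<exists>C. compactin K C \<and> (\<forall>t\<in>topspace K - C. cmod (f t) < 1 / real (Suc n))" for n
    using assms(1) by (simp add: C0_def)
  then obtain C where C: "\<And>n. compactin K (C n)"
    "\<And>n t. t \<in> topspace K - C n \<Longrightarrow> cmod (f t) < 1 / real (Suc n)"
    by metis
  have "{t \<in> A. f t \<noteq> 0} \<subseteq> (\<Union>n. A \<inter> C n)"
  proof
    fix t assume t: "t \<in> {t \<in> A. f t \<noteq> 0}"
    then obtain n where n: "inverse (real (Suc n)) < cmod (f t)"
      using reals_Archimedean[of "cmod (f t)"] by auto
    have "t \<in> topspace K"
      using t closedin_subset[OF assms(2)] by auto
    then show "t \<in> (\<Union>n. A \<inter> C n)"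
      using t n C(2)[of t n] by (force simp: inverse_eq_divide)
  qed
  then show ?thesis
    using closed_Int_compactin[OF assms(2) C(1)] by (intro exI[of _ "\<lambda>n. A \<inter> C n"]) auto
qed

lemma C0_bump:
  assumes "LCH_space K" "compactin K D"
  shows "\<exists>u \<in> C0 K. (\<forall>t. cmod (u t) \<le> 1) \<and> (\<forall>t\<in>D. u t = 1)"
proof -
  have lc: "locally_compact_space K" and Hd: "Hausdorff_space K"
    using assms(1) by (auto simp: LCH_space_def)
  obtain U L where UL: "openin K U" "compactin K L" "D \<subseteq> U" "U \<subseteq> L"
    using lc Hd assms(2) locally_compact_space_compact_closed_compact by metis
  have "completely_regular_space K"
    using lc Hd by (simp add: locally_compact_regular_imp_completely_regular_space)
  moreover have "closedin K (topspace K - U)" "disjnt (topspace K - U) D"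
    using UL by (auto simp: disjnt_def)
  \<comment> \<open>Urysohn's lemma puts the compact set at the lower endpoint and the closed set at
    the upper one. With the interval from -1 to 0, negation yields 1 on \<open>D\<close> and 0
    outside \<open>U\<close>.\<close>
  ultimately obtain f :: "'a \<Rightarrow> real" where f: "continuous_map K (top_of_set {-1..0}) f"
    "f ` D \<subseteq> {-1}" "f ` (topspace K - U) \<subseteq> {0}"
    using Urysohn_completely_regular_closed_compact[of "-1" 0 K "topspace K - U" D] assms(2)
    by auto
  define u where "u = (\<lambda>t. if t \<in> topspace K then complex_of_real (- f t) else 0)"
  have fK: "f t \<in> {-1..0}" if "t \<in> topspace K" for t
    using f(1) that continuous_map_image_subset_topspace by fastforce
  have "continuous_map K euclidean f"
    using f(1) continuous_map_in_subtopology by blast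
  moreover have "continuous_map euclidean euclidean (\<lambda>x :: real. complex_of_real (- x))"
    unfolding continuous_map_iff_continuous2 by (intro continuous_intros)
  ultimately have "continuous_map K euclidean (\<lambda>t. complex_of_real (- f t))"
    using continuous_map_compose[of K euclidean f euclidean "\<lambda>x. complex_of_real (- x)"]
    by (simp add: o_def)
  then have "continuous_map K euclidean u"
    by (rule continuous_map_eq) (simp add: u_def)
  moreover have "\<forall>t\<in>topspace K - L. u t = 0"
    using f(3) UL(4) by (auto simp: u_def)
  ultimately have "u \<in> C0 K"
    using UL(2) by (fastforce simp: C0_def cont_fun_def u_def)
  moreover have "cmod (u t) \<le> 1" for t
    using fK[of t] by (simp add: u_def)
  moreover have "u t = 1" if "t \<in> D" for t
    using f(2) that compactin_subset_topspace[OF assms(2)] by (force simp: u_def)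
  ultimately show ?thesis
    by blast
qed

section \<open>States\<close>

lemma
  assumes "\<phi> \<in> states A"
  shows state_add: "a \<in> A \<Longrightarrow> b \<in> A \<Longrightarrow> \<phi> (a + b) = \<phi> a + \<phi> b"
    and state_fscale: "a \<in> A \<Longrightarrow> \<phi> (fscale c a) = c * \<phi> a"
    and state_finner_nonneg: "a \<in> A \<Longrightarrow> \<phi> (finner a a) \<in> \<real>\<^sub>\<ge>\<^sub>0"
    and state_bdd_above: "bdd_above ((\<lambda>a. cmod (\<phi> a)) ` {a \<in> A. fnorm a \<le> 1})"
    and state_SUP: "(SUP a \<in> {a \<in> A. fnorm a \<le> 1}. cmod (\<phi> a)) = 1"
  using assms by (auto simp: states_def)

lemma state_cmod_le_1:
  assumes "\<phi> \<in> states A" "a \<in> A" "\<And>t. cmod (a t) \<le> 1"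
  shows "cmod (\<phi> a) \<le> 1"
proof -
  have "cmod (\<phi> a) \<le> (SUP a \<in> {a \<in> A. fnorm a \<le> 1}. cmod (\<phi> a))"
    using assms by (intro cSUP_upper state_bdd_above) (auto intro: fnorm_le)
  then show ?thesis
    using state_SUP[OF assms(1)] by simp
qed

lemma state_cmod_le:
  assumes "\<phi> \<in> states A" "a \<in> A" "\<And>c. fscale c a \<in> A" "\<And>t. cmod (a t) \<le> M"
  shows "cmod (\<phi> a) \<le> M"
\<comment> \<open>Scaling by 1/c for every c > M, instead of by 1/M, covers the case M = 0.\<close>
proof (rule dense_ge)
  fix c assume "M < c"
  then have c: "c > 0"
    using assms(4)[of undefined] norm_ge_zero order_trans le_less_trans by blast
  have "cmod (\<phi> (fscale (of_real (1 / c)) a)) \<le> 1"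
  proof (rule state_cmod_le_1[OF assms(1,3)])
    fix t
    show "cmod (fscale (of_real (1 / c)) a t) \<le> 1"
      using assms(4)[of t] c \<open>M < c\<close> by (simp add: norm_divide)
  qed
  then show "cmod (\<phi> a) \<le> c"
    using c assms(1,2) by (simp add: state_fscale norm_mult norm_divide field_simps)
qed

lemma state_zero:
  assumes "\<phi> \<in> states A" "0 \<in> A"
  shows "\<phi> 0 = 0"
  using state_add[OF assms(1), of 0 0] assms(2) by simp

lemma state_sum_fscale:
  assumes "\<phi> \<in> states (C0 K)" "\<And>i. i \<in> I \<Longrightarrow> f i \<in> C0 K"
  shows "\<phi> (\<Sum>i\<in>I. fscale (c i) (f i)) = (\<Sum>i\<in>I. c i * \<phi> (f i))"
  using assms(2)
proof (induction I rule: infinite_finite_induct)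
  case (insert j I)
  have "\<phi> (\<Sum>i\<in>insert j I. fscale (c i) (f i)) =
      \<phi> (fscale (c j) (f j) + (\<Sum>i\<in>I. fscale (c i) (f i)))"
    by (simp only: sum.insert[OF insert.hyps])
  also have "\<dots> = c j * \<phi> (f j) + (\<Sum>i\<in>I. c i * \<phi> (f i))"
  proof -
    have "fscale (c j) (f j) \<in> C0 K" "(\<Sum>i\<in>I. fscale (c i) (f i)) \<in> C0 K"
      using insert.prems by (auto intro!: C0_fscale C0_sum)
    then show ?thesis
      using insert.IH[OF insert.prems[OF insertI2]] insert.prems[OF insertI1]
      by (simp only: state_add[OF assms(1)] state_fscale[OF assms(1)])
  qed
  finally show ?case
    by (simp only: sum.insert[OF insert.hyps])
qed (use state_zero[OF assms(1) C0_zero] in auto)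

lemma state_diff:
  assumes "\<phi> \<in> states (C0 K)" "a \<in> C0 K" "b \<in> C0 K"
  shows "\<phi> (a - b) = \<phi> a - \<phi> b"
  using state_add[OF assms(1) C0_diff[OF assms(2,3)] assms(3)] by simp

text \<open>If \<open>a\<close> nearly attains the norm of the state and \<open>f\<close> has disjoint support from \<open>a\<close>, then
  \<open>a + w f\<close> is in the unit ball whenever \<open>a\<close> and \<open>w f\<close> are, which leaves no room for \<open>\<phi> f\<close>.\<close>

lemma state_sigma_compact_support:
  assumes \<phi>: "\<phi> \<in> states (C0 K)"
  shows "\<exists>a :: nat \<Rightarrow> 'k \<Rightarrow> complex. (\<forall>n. a n \<in> C0 K) \<and>
    (\<forall>f \<in> C0 K. (\<forall>n t. a n t \<noteq> 0 \<longrightarrow> f t = 0) \<longrightarrow> \<phi> f = 0)"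
proof -
  have "\<exists>a. a \<in> C0 K \<and> fnorm a \<le> 1 \<and> 1 - 1 / real (Suc n) < cmod (\<phi> a)" for n
  proof -
    have "0 \<in> {a \<in> C0 K. fnorm a \<le> 1}"
      by (auto simp: C0_zero intro: fnorm_le)
    then have "{a \<in> C0 K. fnorm a \<le> 1} \<noteq> {}"
      by blast
    moreover have "1 - 1 / real (Suc n) < (SUP a \<in> {a \<in> C0 K. fnorm a \<le> 1}. cmod (\<phi> a))"
      using state_SUP[OF \<phi>] by simp
    ultimately show ?thesis
      using less_cSUP_iff[OF _ state_bdd_above[OF \<phi>]] by blast
  qed
  then obtain a where a: "\<And>n. a n \<in> C0 K" "\<And>n. fnorm (a n) \<le> 1"
    "\<And>n :: nat. 1 - 1 / real (Suc n) < cmod (\<phi> (a n))"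
    by metis
  have a_le: "cmod (a n t) \<le> 1" for n t
    using cmod_le_fnorm[OF C0_bounded[OF a(1)[of n]], of t] a(2)[of n] by simp
  have "\<phi> f = 0" if f: "f \<in> C0 K" and disj: "\<And>n t. a n t \<noteq> 0 \<Longrightarrow> f t = 0" for f
  proof (rule ccontr)
    assume "\<phi> f \<noteq> 0"
    obtain M where M: "M > 0" "\<And>t. cmod (f t) \<le> M"
      using C0_bounded[OF f] by (auto simp: bounded_pos)
    have "cmod (\<phi> f) / M \<le> 1 / real (Suc n)" for n
    proof -
      have pos: "cmod (\<phi> (a n)) > 0"
        using a(3)[of n] by (rule le_less_trans[rotated]) (simp add: field_simps)
      \<comment> \<open>The phase of \<open>w\<close> aligns \<phi>(w f) with \<phi>(a n), so that
        their moduli add; the modulus 1/M keeps \<open>w f\<close> in the unit ball.\<close>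
      define w where "w = sgn (\<phi> (a n)) * cnj (sgn (\<phi> f)) / of_real M"
      have w: "cmod w = 1 / M"
        using pos \<open>\<phi> f \<noteq> 0\<close> M(1) by (simp add: w_def norm_mult norm_divide norm_sgn)
      have "w * \<phi> f = sgn (\<phi> (a n)) * (cnj (sgn (\<phi> f)) * \<phi> f) / of_real M"
        by (simp add: w_def)
      also have "cnj (sgn (\<phi> f)) * \<phi> f = of_real (cmod (\<phi> f))"
        by (simp add: sgn_div_norm scaleR_conv_of_real complex_norm_square[symmetric]
            power2_eq_square[of "cmod _"] field_simps \<open>\<phi> f \<noteq> 0\<close>)
      finally have "\<phi> (a n) + w * \<phi> f =
          sgn (\<phi> (a n)) * of_real (cmod (\<phi> (a n)) + cmod (\<phi> f) / M)"
        using pos by (simp add: algebra_simps sgn_div_norm scaleR_conv_of_real field_simps)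
      then have eq: "cmod (\<phi> (a n + fscale w f)) = cmod (\<phi> (a n)) + cmod (\<phi> f) / M"
        using pos M(1) a(1) f
        by (simp add: state_add[OF \<phi>] state_fscale[OF \<phi>] C0_fscale norm_mult norm_sgn
            del: of_real_add of_real_divide)
      have "cmod (\<phi> (a n + fscale w f)) \<le> 1"
      proof (rule state_cmod_le_1[OF \<phi>])
        show "a n + fscale w f \<in> C0 K"
          using a(1) f by (intro C0_add C0_fscale)
        show "cmod ((a n + fscale w f) t) \<le> 1" for t
          using disj[of n t] a_le[of n t] M(1) M(2)[of t] w
          by (cases "a n t = 0") (auto simp: norm_mult)
      qed
      then show ?thesis
        using eq a(3)[of n] by linarith
    qed
    moreover obtain n where "1 / real (Suc n) < cmod (\<phi> f) / M"
      using reals_Archimedean[of "cmod (\<phi> f) / M"] M(1) \<open>\<phi> f \<noteq> 0\<close>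
      by (auto simp: inverse_eq_divide)
    ultimately show False
      by (meson not_less)
  qed
  then show ?thesis
    using a(1) by blast
qed

text \<open>A duality argument: with c_i = \<phi>(\<langle>y, X_i\<rangle>), the combination of the
  \<langle>y, X_i\<rangle> with coefficients cnj c_i is sent by \<phi> to S, the sum of the |c_i|^2,
  whereas Cauchy-Schwarz at each point bounds its modulus by M sqrt(S) sqrt(B). Dividing by sqrt(S)
  gives the claim. A bound on the X_i that is uniform in the point thus becomes a bound that is
  uniform in the state.\<close>

lemma state_Bessel:
  assumes \<phi>: "\<phi> \<in> states (C0 K)" and y: "y \<in> C0 K" "\<And>t. cmod (y t) \<le> M"
    and X: "\<And>i. i \<in> I \<Longrightarrow> X i \<in> Cb K"
    and B: "B \<ge> 0" "\<And>t. (\<Sum>i\<in>I. (cmod (X i t))\<^sup>2) \<le> B"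
  shows "(\<Sum>i\<in>I. (cmod (\<phi> (finner y (X i))))\<^sup>2) \<le> M\<^sup>2 * B"
proof -
  define c where "c i = \<phi> (finner y (X i))" for i
  define S where "S = (\<Sum>i\<in>I. (cmod (c i))\<^sup>2)"
  define f where "f = (\<Sum>i\<in>I. fscale (cnj (c i)) (finner y (X i)))"
  have S: "S \<ge> 0"
    by (simp add: S_def sum_nonneg)
  have M: "M \<ge> 0"
    using y(2)[of undefined] norm_ge_zero order_trans by blast
  have f: "f \<in> C0 K"
    unfolding f_def using X y by (intro C0_sum C0_fscale finner_C0_left)
  have "\<phi> f = (\<Sum>i\<in>I. cnj (c i) * c i)"
    unfolding f_def c_def using X y by (intro state_sum_fscale[OF \<phi>] finner_C0_left)
  also have "\<dots> = of_real S"
    by (simp add: S_def complex_norm_square[symmetric] mult.commute del: of_real_power)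
  finally have "S = cmod (\<phi> f)"
    using S by simp
  also have "\<dots> \<le> M * (sqrt S * sqrt B)"
  proof (rule state_cmod_le[OF \<phi> f])
    fix t
    have "cmod (f t) \<le> (\<Sum>i\<in>I. cmod (y t) * (\<bar>cmod (c i)\<bar> * \<bar>cmod (X i t)\<bar>))"
      unfolding f_def sum_fun_apply by (rule sum_norm_le) (simp add: norm_mult mult.left_commute)
    also have "\<dots> = cmod (y t) * (\<Sum>i\<in>I. \<bar>cmod (c i)\<bar> * \<bar>cmod (X i t)\<bar>)"
      by (simp add: sum_distrib_left)
    also have "\<dots> \<le> M * (\<Sum>i\<in>I. \<bar>cmod (c i)\<bar> * \<bar>cmod (X i t)\<bar>)"
      by (intro mult_right_mono y(2) sum_nonneg) auto
    also have "\<dots> \<le> M * (sqrt S * sqrt B)"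
    proof (intro mult_left_mono M)
      have "(\<Sum>i\<in>I. \<bar>cmod (c i)\<bar> * \<bar>cmod (X i t)\<bar>) \<le>
          L2_set (\<lambda>i. cmod (c i)) I * L2_set (\<lambda>i. cmod (X i t)) I"
        by (rule L2_set_mult_ineq)
      also have "\<dots> \<le> sqrt S * sqrt B"
        using B(2)[of t] S by (auto simp: L2_set_def S_def intro!: mult_left_mono)
      finally show "(\<Sum>i\<in>I. \<bar>cmod (c i)\<bar> * \<bar>cmod (X i t)\<bar>) \<le> sqrt S * sqrt B" .
    qed
    finally show "cmod (f t) \<le> M * (sqrt S * sqrt B)" .
  qed (rule C0_fscale[OF f])
  finally have "sqrt S * sqrt S \<le> (M * sqrt B) * sqrt S"
    using S by (simp add: mult_ac)
  then have "sqrt S \<le> M * sqrt B"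
  proof (cases "S = 0")
    case True
    then show ?thesis
      using M B(1) by simp
  next
    case False
    assume "sqrt S * sqrt S \<le> (M * sqrt B) * sqrt S"
    then show ?thesis
      by (rule mult_right_le_imp_le) (use S False in simp)
  qed
  then have "(sqrt S)\<^sup>2 \<le> (M * sqrt B)\<^sup>2"
    using S by (intro power_mono) auto
  then show ?thesis
    using S B(1) by (simp add: S_def c_def power_mult_distrib)
qed

section \<open>Total boundedness\<close>

text \<open>Pigeonhole: rounding the real and imaginary parts of all values \<open>g i y\<close>
  labels each y by an element of a finite set. \<open>inv_into\<close> picks one representative per
  label inside \<open>Y\<close>, as total boundedness requires its centres to lie in
  \<open>Y\<close>.\<close>

lemma finite_simultaneous_net:
  fixes g :: "'i \<Rightarrow> 'y \<Rightarrow> complex"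
  assumes "finite I" "e > 0" and B: "\<And>i y. i \<in> I \<Longrightarrow> y \<in> Y \<Longrightarrow> cmod (g i y) \<le> B"
  shows "\<exists>Z. finite Z \<and> Z \<subseteq> Y \<and> (\<forall>y\<in>Y. \<exists>z\<in>Z. \<forall>i\<in>I. cmod (g i z - g i y) \<le> e)"
proof -
  \<comment> \<open>The grid cells have length e/2, since the errors of the real and the imaginary
    part are added.\<close>
  define q where "q r = \<lfloor>r * 2 / e\<rfloor>" for r :: real
  define lab where "lab y = (\<lambda>i\<in>I. (q (Re (g i y)), q (Im (g i y))))" for y
  define R where "R = {q (- B)..q B}"
  have q_mono: "q r \<le> q s" if "r \<le> s" for r s
    unfolding q_def using that \<open>e > 0\<close> by (intro floor_mono) (simp add: divide_right_mono)
  have q_in_R: "q r \<in> R" if "\<bar>r\<bar> \<le> B" for r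
    using that by (auto simp: R_def intro!: q_mono)
  have "lab ` Y \<subseteq> (\<Pi>\<^sub>E i\<in>I. R \<times> R)"
    using B abs_Re_le_cmod abs_Im_le_cmod
    by (fastforce simp: lab_def intro!: q_in_R intro: order_trans)
  then have "finite (lab ` Y)"
    by (rule finite_subset) (auto simp: R_def intro: finite_PiE \<open>finite I\<close>)
  then have "finite (inv_into Y lab ` lab ` Y)"
    by simp
  moreover have "inv_into Y lab ` lab ` Y \<subseteq> Y"
    by (auto intro: inv_into_into)
  moreover have "\<exists>z \<in> inv_into Y lab ` lab ` Y. \<forall>i\<in>I. cmod (g i z - g i y) \<le> e"
    if "y \<in> Y" for y
  proof (intro bexI ballI)
    let ?z = "inv_into Y lab (lab y)"
    show "?z \<in> inv_into Y lab ` lab ` Y"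
      using that by blast
    fix i assume "i \<in> I"
    have "lab ?z = lab y"
      using that by (simp add: f_inv_into_f)
    then have "lab ?z i = lab y i"
      by simp
    then have eq: "q (Re (g i ?z)) = q (Re (g i y))" "q (Im (g i ?z)) = q (Im (g i y))"
      using \<open>i \<in> I\<close> by (auto simp: lab_def)
    have close: "\<bar>r - s\<bar> \<le> e / 2" if "q r = q s" for r s
    proof -
      have "\<bar>r * 2 / e - s * 2 / e\<bar> < 1"
        using that unfolding q_def by linarith
      also have "r * 2 / e - s * 2 / e = (r - s) * 2 / e"
        by (simp add: algebra_simps diff_divide_distrib)
      finally have "\<bar>r * 2 - s * 2\<bar> < e"
        using \<open>e > 0\<close> by (simp add: abs_mult field_simps)
      then show ?thesis
        by linarith
    qed
    have "cmod (g i ?z - g i y) \<le> \<bar>Re (g i ?z - g i y)\<bar> + \<bar>Im (g i ?z - g i y)\<bar>"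
      by (rule cmod_le)
    also have "\<dots> \<le> e"
      using close[OF eq(1)] close[OF eq(2)] by simp
    finally show "cmod (g i ?z - g i y) \<le> e" .
  qed
  ultimately show ?thesis
    by blast
qed

text \<open>Describes the copy of P_1 inside K. Being clopen makes its indicator continuous; the
  last assumption is the precompactness of \<sigma>-compact subsets, in the form in which it is
  applied.\<close>

locale sigma_precompact_clopen =
  fixes K :: "'a topology" and A :: "'a set"
  assumes LCH: "LCH_space K" and openin: "openin K A" and closedin: "closedin K A"
    and not_compact: "\<not> compactin K A"
    and sigma_compact_bound: "\<And>C :: nat \<Rightarrow> 'a set. (\<And>n. compactin K (C n)) \<Longrightarrow>
      (\<And>n. C n \<subseteq> A) \<Longrightarrow> \<exists>D. compactin K D \<and> D \<subseteq> A \<and> (\<Union>n. C n) \<subseteq> D"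
begin

lemma sigma_compact_bound_countable:
  assumes "countable \<C>" "\<And>C. C \<in> \<C> \<Longrightarrow> compactin K C \<and> C \<subseteq> A"
  shows "\<exists>D. compactin K D \<and> D \<subseteq> A \<and> \<Union>\<C> \<subseteq> D"
proof (cases "\<C> = {}")
  case True
  then show ?thesis by (auto intro!: exI[of _ "{}"])
next
  case False
  then have "range (from_nat_into \<C>) = \<C>"
    by (simp add: assms(1) range_from_nat_into)
  moreover have "compactin K (from_nat_into \<C> n)" "from_nat_into \<C> n \<subseteq> A" for n
    using assms(2)[OF from_nat_into[OF False]] by auto
  ultimately show ?thesis
    using sigma_compact_bound[of "from_nat_into \<C>"] by simp
qed

text \<open>Each nonzero set is \<sigma>-compact on \<open>A\<close>, and countably many
  \<sigma>-compact sets still fit into one compact subset of \<open>A\<close>. This turns the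
  topological hypothesis into a statement about functions, applied to states as well as to
  frames.\<close>

lemma C0_countable_support:
  assumes "countable \<F>" "\<F> \<subseteq> C0 K"
  shows "\<exists>D. compactin K D \<and> D \<subseteq> A \<and> (\<forall>f\<in>\<F>. \<forall>t\<in>A. f t \<noteq> 0 \<longrightarrow> t \<in> D)"
proof -
  have "\<exists>C :: nat \<Rightarrow> 'a set. (\<forall>n. compactin K (C n) \<and> C n \<subseteq> A) \<and>
      {t \<in> A. f t \<noteq> 0} \<subseteq> (\<Union>n. C n)" if "f \<in> \<F>" for f
    using C0_nonzero_sigma_compact closedin assms(2) that by blast
  then obtain C :: "('a \<Rightarrow> complex) \<Rightarrow> nat \<Rightarrow> 'a set" where
    C: "\<And>f n. f \<in> \<F> \<Longrightarrow> compactin K (C f n) \<and> C f n \<subseteq> A"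
    "\<And>f. f \<in> \<F> \<Longrightarrow> {t \<in> A. f t \<noteq> 0} \<subseteq> (\<Union>n. C f n)"
    by metis
  have "countable (\<Union>f\<in>\<F>. range (C f))"
    using assms(1) by auto
  then obtain D where D: "compactin K D" "D \<subseteq> A" "\<Union> (\<Union>f\<in>\<F>. range (C f)) \<subseteq> D"
    using sigma_compact_bound_countable[of "\<Union>f\<in>\<F>. range (C f)"] C(1) by blast
  have "t \<in> D" if f: "f \<in> \<F>" and t: "t \<in> A" "f t \<noteq> 0" for f t
  proof -
    obtain n where "t \<in> C f n"
      using C(2)[OF f] t by auto
    then show ?thesis
      using D(3) f by blast
  qed
  then show ?thesis
    using D(1,2) by blast
qed

section \<open>Multiplication by the indicator: adjointable, not compact\<close>

lemma indicator_mult_C0: "x \<in> C0 K \<Longrightarrow> indicator A * x \<in> C0 K"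
proof -
  assume x: "x \<in> C0 K"
  have "indicator A \<in> Cb K"
    unfolding Cb_def bounded_iff mem_Collect_eq
    by (intro conjI cont_fun_indicator openin closedin exI[of _ 1]) (auto simp: indicator_def)
  from C0_mult_Cb[OF x this] show ?thesis
    by (simp add: mult.commute)
qed

text \<open>The indicator is real-valued, so the operator is its own adjoint.\<close>

lemma adjointable_indicator: "adjointable (C0 K) finner (C0 K) finner ((*) (indicator A))"
  unfolding adjointable_def
proof (intro conjI bexI ballI)
  show "(*) (indicator A) \<in> C0 K \<rightarrow> C0 K"
    using indicator_mult_C0 by blast
  then show "(*) (indicator A) \<in> C0 K \<rightarrow> C0 K" .
  fix x y :: "'a \<Rightarrow> complex"
  show "finner (indicator A * x) y = finner x (indicator A * y)"
    by (rule ext) (simp add: indicator_def)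
qed

lemma not_module_compact_indicator: "\<not> module_compact (C0 K) (C0 K) ((*) (indicator A))"
proof
  assume "module_compact (C0 K) (C0 K) ((*) (indicator A))"
  then obtain S where S: "S \<in> elementary_span (C0 K) (C0 K)"
    "\<And>z. z \<in> C0 K \<Longrightarrow> fnorm (indicator A * z - S z) \<le> 1/2 * fnorm z"
    unfolding module_compact_def using half_gt_zero[OF zero_less_one] by blast
  then obtain n :: nat and c x y where xy: "\<And>i. i < n \<Longrightarrow> x i \<in> C0 K \<and> y i \<in> C0 K"
    and S_eq: "S = (\<lambda>z. \<Sum>i<n. fscale (c i) (elementary_op (x i) (y i) z))"
    unfolding elementary_span_def by blast
  \<comment> \<open>An elementary operator sends z to x (cnj y) z, so by commutativity the whole
    span consists of multiplications by functions in \<open>C0 K\<close>.\<close>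
  define h where "h = (\<Sum>i<n. fscale (c i) (finner (y i) (x i)))"
  have h: "h \<in> C0 K"
    unfolding h_def using xy by (intro C0_sum C0_fscale finner_C0_left C0_imp_Cb) auto
  have S_h: "S z = h * z" for z
    by (rule ext) (simp add: S_eq h_def elementary_op_def sum_distrib_left mult_ac)
  \<comment> \<open>Any bound below 1/2 would do: at a point of \<open>A\<close> outside
    \<open>C\<close> a bump function with value 1 forces |1 - h(t)| to be at most 1/2.\<close>
  obtain C where C: "compactin K C" "\<And>t. t \<in> topspace K - C \<Longrightarrow> cmod (h t) < 1/4"
    using C0_small_outside[OF h zero_less_divide_1_iff[THEN iffD2, OF zero_less_numeral]] by blast
  have "compactin K (A \<inter> C)"
    using closedin C(1) by (rule closed_Int_compactin)
  then obtain t where t: "t \<in> A" "t \<notin> C"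
    using not_compact by (metis inf.absorb1 subsetI)
  have tK: "t \<in> topspace K"
    using t(1) openin_subset[OF openin] by auto
  have "compactin K {t}"
    using tK by simp
  then obtain u where u: "u \<in> C0 K" "\<And>t. cmod (u t) \<le> 1" "u t = 1"
    using C0_bump[OF LCH] by blast
  have "cmod ((indicator A * u - S u) t) \<le> fnorm (indicator A * u - S u)"
    unfolding S_h
    by (intro cmod_le_fnorm C0_bounded[of _ K] C0_diff indicator_mult_C0[OF u(1)] C0_mult[OF h u(1)])
  also have "\<dots> \<le> 1/2 * fnorm u"
    using S(2) u(1) by blast
  also have "\<dots> \<le> 1/2"
    using fnorm_le[of u 1] u(2) by simp
  finally have "cmod (1 - h t) \<le> 1/2"
    using t u(3) by (simp add: S_h)
  moreover have "cmod (h t) < 1/4"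
    using C(2) t tK by blast
  ultimately show False
    using norm_triangle_ineq2[of 1 "h t"] by simp
qed

section \<open>Total boundedness of bounded sets of functions supported in the clopen piece\<close>

text \<open>Each state is carried by the nonzero sets of countably many functions. Together these
  are still countably many, so one compact \<open>D\<close> contains all their nonzero sets within
  \<open>A\<close>, and an \<open>f\<close> living on \<open>A - D\<close> is disjoint from every
  one of them.\<close>

lemma states_common_compact:
  assumes "\<And>k :: nat. \<Phi> k \<in> states (C0 K)"
  shows "\<exists>D. compactin K D \<and> D \<subseteq> A \<and>
    (\<forall>k. \<forall>f \<in> C0 K. (\<forall>t. t \<in> D \<or> t \<notin> A \<longrightarrow> f t = 0) \<longrightarrow> \<Phi> k f = 0)"
proof -
  obtain a :: "nat \<Rightarrow> nat \<Rightarrow> 'a \<Rightarrow> complex" where a: "\<And>k n. a k n \<in> C0 K"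
    "\<And>k f. f \<in> C0 K \<Longrightarrow> (\<And>n t. a k n t \<noteq> 0 \<Longrightarrow> f t = 0) \<Longrightarrow> \<Phi> k f = 0"
    using state_sigma_compact_support[OF assms] by metis
  have "countable (range (case_prod a))"
    by simp
  then obtain D where D: "compactin K D" "D \<subseteq> A" "\<And>k n t. t \<in> A \<Longrightarrow> a k n t \<noteq> 0 \<Longrightarrow> t \<in> D"
    using C0_countable_support[of "range (case_prod a)"] a(1) by fastforce
  have "\<Phi> k f = 0" if "f \<in> C0 K" "\<forall>t. t \<in> D \<or> t \<notin> A \<longrightarrow> f t = 0" for k f
    using that D(3) by (intro a(2)) blast+
  then show ?thesis
    using D by blast
qed

lemma totally_bounded_supported:
  assumes Y: "Y \<subseteq> C0 K" "\<And>y t. y \<in> Y \<Longrightarrow> cmod (y t) \<le> 1" "\<And>y t. y \<in> Y \<Longrightarrow> t \<notin> A \<Longrightarrow> y t = 0"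
  shows "Cb_C0_totally_bounded K Y"
  unfolding Cb_C0_totally_bounded_def
proof (intro allI impI, elim conjE)
  fix X :: "nat \<Rightarrow> 'a \<Rightarrow> complex" and \<Phi> :: "nat \<Rightarrow> ('a \<Rightarrow> complex) \<Rightarrow> complex" and e :: real
  assume adm: "outer_admissible K X" and "\<forall>k. \<Phi> k \<in> states (C0 K)" and "e > 0"
  then have \<Phi>: "\<Phi> k \<in> states (C0 K)" for k
    by blast
  have X: "X i \<in> Cb K" "cmod (X i t) \<le> 1" for i t
  proof -
    show "X i \<in> Cb K"
      using adm by (simp add: outer_admissible_def)
    then have "cmod (X i t) \<le> fnorm (X i)"
      by (intro cmod_le_fnorm) (simp add: Cb_def)
    then show "cmod (X i t) \<le> 1"
      using adm by (simp add: outer_admissible_def) (meson order_trans)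
  qed
  obtain D where D: "compactin K D" "D \<subseteq> A"
    "\<forall>k. \<forall>f \<in> C0 K. (\<forall>t. t \<in> D \<or> t \<notin> A \<longrightarrow> f t = 0) \<longrightarrow> \<Phi> k f = 0"
    using states_common_compact[of \<Phi>, OF \<Phi>] by blast
  \<comment> \<open>Admissibility is applied to this single function; it yields norm convergence of
    the sum of |u X_i|^2, hence uniform control on \<open>D\<close>.\<close>
  obtain u where u: "u \<in> C0 K" "\<And>t. cmod (u t) \<le> 1" "\<And>t. t \<in> D \<Longrightarrow> u t = 1"
    using C0_bump[OF LCH D(1)] by blast
  have uX: "u * X i \<in> C0 K" for i
    using u(1) X(1) by (rule C0_mult_Cb)
  obtain s where s: "s \<in> C0 K"
    "norm_tendsto (\<lambda>n. \<Sum>i<n. finner u (X i) * finner (X i) u) s sequentially"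
    using adm u(1) unfolding outer_admissible_def by blast
  define part where "part n = (\<Sum>i<n. finner u (X i) * finner (X i) u)" for n
  have part: "part n \<in> C0 K" for n
    unfolding part_def using u(1) X(1) by (intro C0_sum C0_mult finner_C0_left finner_C0_right)
  have part_apply: "part n t = of_real (\<Sum>i<n. (cmod ((u * X i) t))\<^sup>2)" for n t
    unfolding part_def of_real_sum complex_norm_square by (simp add: mult_ac)
  \<comment> \<open>Chosen for the Bessel bound with M = 2 (a difference of two functions bounded by
    1) and B = 2\<delta>: it gives 8\<delta> = e^2/8.\<close>
  define \<delta> where "\<delta> = e\<^sup>2 / 64"
  have "\<delta> > 0"
    using \<open>e > 0\<close> by (simp add: \<delta>_def)
  then obtain N where N: "\<And>n. n \<ge> N \<Longrightarrow> fnorm (part n - s) < \<delta>"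
  proof -
    have "(\<lambda>n. fnorm (part n - s)) \<longlonglongrightarrow> 0"
      using s(2) by (simp add: norm_tendsto_def part_def)
    then have "\<forall>\<^sub>F n in sequentially. fnorm (part n - s) < \<delta>"
      using \<open>\<delta> > 0\<close> by (rule order_tendstoD)
    then show thesis
      using that by (auto simp: eventually_sequentially)
  qed
  \<comment> \<open>A block of the series is a difference of two partial sums, each within \<delta>
    of the limit \<open>s\<close>.\<close>
  have tail: "(\<Sum>i\<in>{m..<n}. (cmod ((u * X i) t))\<^sup>2) \<le> 2 * \<delta>" if "N \<le> m" for m n t
  proof (cases "m \<le> n")
    case True
    have close: "cmod (part n t - s t) < \<delta>" if "n \<ge> N" for n
      using cmod_le_fnorm[OF C0_bounded[OF C0_diff[OF part s(1)]], of n t] N[OF that] by simp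
    have "(\<Sum>i\<in>{m..<n}. (cmod ((u * X i) t))\<^sup>2) =
        (\<Sum>i<n. (cmod ((u * X i) t))\<^sup>2) - (\<Sum>i<m. (cmod ((u * X i) t))\<^sup>2)"
      using sum_diff_nat_ivl[of 0 m n "\<lambda>i. (cmod ((u * X i) t))\<^sup>2"] True
      by (simp add: atLeast0LessThan)
    also have "\<dots> = Re (part n t - part m t)"
      by (simp add: part_apply)
    also have "\<dots> \<le> cmod ((part n t - s t) - (part m t - s t))"
      using complex_Re_le_cmod[of "part n t - part m t"] by simp
    also have "\<dots> \<le> cmod (part n t - s t) + cmod (part m t - s t)"
      by (rule norm_triangle_ineq4)
    also have "\<dots> \<le> 2 * \<delta>"
      using close[of n] close[of m] that True by simp
    finally show ?thesis .
  next
    case False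
    then show ?thesis using \<open>\<delta> > 0\<close> by simp
  qed
  \<comment> \<open>At most N head terms, each at most \<eta>^2, add up to at most e^2/8. The
    summand 1 keeps the quotient meaningful when N = 0.\<close>
  define \<eta> where "\<eta> = sqrt (e\<^sup>2 / (8 * (real N + 1)))"
  have "\<eta> > 0"
    using \<open>e > 0\<close> by (simp add: \<eta>_def)
  have \<eta>: "real N * \<eta>\<^sup>2 \<le> e\<^sup>2 / 8"
    by (simp add: \<eta>_def field_simps)
  \<comment> \<open>A common net for the finitely many functionals with k, i < N, which produce all
    head terms.\<close>
  obtain Z where Z: "finite Z" "Z \<subseteq> Y" "\<And>y. y \<in> Y \<Longrightarrow> \<exists>z\<in>Z. \<forall>p\<in>{..<N}\<times>{..<N}.
      cmod (\<Phi> (fst p) (finner z (X (snd p))) - \<Phi> (fst p) (finner y (X (snd p)))) \<le> \<eta>"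
  proof -
    have "cmod (\<Phi> (fst p) (finner y (X (snd p)))) \<le> 1" if "y \<in> Y" for p y
    proof (rule state_cmod_le_1[OF \<Phi>])
      show "finner y (X (snd p)) \<in> C0 K"
        using that Y(1) X(1) by (intro finner_C0_left) auto
      show "cmod (finner y (X (snd p)) t) \<le> 1" for t
        using Y(2)[OF that] X(2) by (simp add: norm_mult mult_le_one)
    qed
    then show thesis
      using finite_simultaneous_net[of "{..<N}\<times>{..<N}" \<eta> Y
          "\<lambda>p y. \<Phi> (fst p) (finner y (X (snd p)))" 1] \<open>\<eta> > 0\<close> that
      by auto
  qed
  have "dXP X \<Phi> z y < e" if zy: "z \<in> Z" "y \<in> Y"
    and net: "\<And>k i. k < N \<Longrightarrow> i < N \<Longrightarrow>
      cmod (\<Phi> k (finner z (X i)) - \<Phi> k (finner y (X i))) \<le> \<eta>" for z y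
  proof -
    have z: "z \<in> Y"
      using zy Z(2) by auto
    have d: "z - y \<in> C0 K"
      using z zy Y(1) by (intro C0_diff) auto
    have d_le: "cmod ((z - y) t) \<le> 2" for t
      using norm_triangle_ineq4[of "z t" "y t"] Y(2)[OF z, of t] Y(2)[OF zy(2), of t] by simp
    define a where "a k i = (cmod (\<Phi> k (finner (z - y) (X i))))\<^sup>2" for k i
    have \<Phi>_diff: "\<Phi> k (finner (z - y) (X i)) = \<Phi> k (finner z (X i)) - \<Phi> k (finner y (X i))" for k i
    proof -
      have "finner (z - y) (X i) = finner z (X i) - finner y (X i)"
        by (rule ext) (simp add: algebra_simps)
      then show ?thesis
        using z zy Y(1) X(1) by (simp add: state_diff[OF \<Phi>] finner_C0_left subset_iff)
    qed
    \<comment> \<open>The two arguments differ by a function vanishing on \<open>D\<close>, where u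
      = 1, and off \<open>A\<close>, where z - y = 0; every state of the family kills such a
      function.\<close>
    have \<Phi>_u: "\<Phi> k (finner (z - y) (X i)) = \<Phi> k (finner (z - y) (u * X i))" for k i
    proof -
      have 1: "finner (z - y) (X i) \<in> C0 K"
        using d X(1) by (rule finner_C0_left)
      have 2: "finner (z - y) (u * X i) \<in> C0 K"
        using d uX by (intro finner_C0_left C0_imp_Cb)
      have "\<Phi> k (finner (z - y) (X i) - finner (z - y) (u * X i)) = 0"
        using u(3) Y(3)[OF z] Y(3)[OF zy(2)]
        by (intro D(3)[rule_format] C0_diff 1 2) auto
      then show ?thesis
        using state_diff[OF \<Phi> 1 2] by simp
    qed
    have a_tail: "(\<Sum>i\<in>{m..<n}. a k i) \<le> e\<^sup>2 / 8" if "N \<le> m" for k m n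
    proof -
      have "(\<Sum>i\<in>{m..<n}. a k i) \<le> 2\<^sup>2 * (2 * \<delta>)"
        unfolding a_def \<Phi>_u using tail[OF that] uX \<open>\<delta> > 0\<close>
        by (intro state_Bessel[OF \<Phi> d d_le]) (auto intro: C0_imp_Cb)
      then show ?thesis
        by (simp add: \<delta>_def)
    qed
    have a_head: "(\<Sum>i\<in>{k..<N}. a k i) \<le> e\<^sup>2 / 8" for k
    proof (cases "k < N")
      case True
      have "(\<Sum>i\<in>{k..<N}. a k i) \<le> real (card {k..<N}) * \<eta>\<^sup>2"
        unfolding a_def \<Phi>_diff using net True by (intro sum_bounded_above power_mono) auto
      also have "\<dots> \<le> real N * \<eta>\<^sup>2"
        by (intro mult_right_mono) auto
      finally show ?thesis
        using \<eta> by simp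
    qed simp
    have a_nonneg: "a k i \<ge> 0" for k i
      by (simp add: a_def)
    \<comment> \<open>The sum is split at N. Head and tail together give e^2/4, and e/2 instead of e
      leaves room for strictness after taking the supremum over k.\<close>
    have a_sum: "(\<Sum>i<n. a k (k + i)) \<le> (e/2)\<^sup>2" for k n
    proof -
      have "(\<Sum>i<n. a k (k + i)) = (\<Sum>i\<in>{k..<k + n}. a k i)"
        using sum.shift_bounds_nat_ivl[of "a k" 0 k n]
        by (simp add: atLeast0LessThan add.commute)
      also have "\<dots> \<le> (\<Sum>i\<in>{k..<N} \<union> {max k N..<k + n}. a k i)"
        by (intro sum_mono2) (auto simp: a_nonneg)
      also have "\<dots> = (\<Sum>i\<in>{k..<N}. a k i) + (\<Sum>i\<in>{max k N..<k + n}. a k i)"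
        by (intro sum.union_disjoint) auto
      also have "\<dots> \<le> e\<^sup>2 / 8 + e\<^sup>2 / 8"
        by (intro add_mono a_head a_tail) auto
      finally show ?thesis
        by (simp add: power_divide)
    qed
    have "(\<Sum>i. a k (k + i)) \<le> (e/2)\<^sup>2" for k
      using a_sum a_nonneg by (intro suminf_le_const summableI_nonneg_bounded) auto
    then have "(SUP k. \<Sum>i. a k (k + i)) \<le> (e/2)\<^sup>2"
      by (intro cSUP_least) auto
    then have "dXP X \<Phi> z y \<le> sqrt ((e/2)\<^sup>2)"
      unfolding dXP_def a_def by (rule real_sqrt_le_mono)
    also have "\<dots> < e"
      using \<open>e > 0\<close> by simp
    finally show ?thesis .
  qed
  then have "Y \<subseteq> (\<Union>z\<in>Z. {y \<in> Y. dXP X \<Phi> z y < e})"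
    using Z(3) by fastforce
  then show "\<exists>Z. finite Z \<and> Z \<subseteq> Y \<and> Y \<subseteq> (\<Union>z\<in>Z. {y \<in> Y. dXP X \<Phi> z y < e})"
    using Z(1,2) by blast
qed

lemma totally_bounded_indicator_image:
  "Cb_C0_totally_bounded K ((*) (indicator A) ` {x \<in> C0 K. fnorm x \<le> 1})"
proof (rule totally_bounded_supported)
  show "(*) (indicator A) ` {x \<in> C0 K. fnorm x \<le> 1} \<subseteq> C0 K"
    by (auto intro: indicator_mult_C0)
next
  fix y t assume "y \<in> (*) (indicator A) ` {x \<in> C0 K. fnorm x \<le> 1}"
  then obtain x where x: "x \<in> C0 K" "fnorm x \<le> 1" "y = indicator A * x"
    by blast
  show "cmod (y t) \<le> 1"
    using cmod_le_fnorm[OF C0_bounded[OF x(1)], of t] x(2,3) by (auto simp: indicator_def)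
  show "y t = 0" if "t \<notin> A"
    using x(3) that by simp
qed

end

section \<open>The unitization\<close>

text \<open>Writing a = f + c and b = g + d, subtracting the constant h(c, d) leaves a continuous
  function of f and g that vanishes at the origin, so the statement for \<open>C0 K\<close> applies.
  Here \<open>h\<close> may be nonlinear, which provides the functional calculus for square
  roots.\<close>

lemma unitization_comp2:
  assumes "a \<in> C0_unitization K" "b \<in> C0_unitization K"
    and "continuous_on UNIV (\<lambda>p. h (fst p) (snd p))" "h 0 0 = 0"
  shows "(\<lambda>t. h (a t) (b t)) \<in> C0_unitization K"
proof -
  obtain f c where f: "f \<in> C0 K" "a = f + fscale c (indicator (topspace K))"
    using assms(1) by (auto simp: C0_unitization_def)
  obtain g d where g: "g \<in> C0 K" "b = g + fscale d (indicator (topspace K))"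
    using assms(2) by (auto simp: C0_unitization_def)
  define k where "k z w = h (z + c) (w + d) - h c d" for z w
  have "continuous_on UNIV (\<lambda>p :: complex \<times> complex. (fst p + c, snd p + d))"
    by (intro continuous_intros)
  from continuous_on_compose2[OF assms(3) this]
  have "continuous_on UNIV (\<lambda>p. k (fst p) (snd p))"
    unfolding k_def by (intro continuous_on_diff continuous_on_const) simp
  moreover have "k 0 0 = 0"
    by (simp add: k_def)
  ultimately have k: "(\<lambda>t. k (f t) (g t)) \<in> C0 K"
    using C0_comp2[OF f(1) g(1), of k] by blast
  have "(\<lambda>t. h (a t) (b t)) = (\<lambda>t. k (f t) (g t)) + fscale (h c d) (indicator (topspace K))"
  proof
    fix t
    have "f t = 0" "g t = 0" if "t \<notin> topspace K"
      using f(1) g(1) that by (auto simp: C0_def cont_fun_def)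
    moreover have "k 0 0 = 0"
      by (simp add: k_def)
    ultimately show "h (a t) (b t) =
        ((\<lambda>t. k (f t) (g t)) + fscale (h c d) (indicator (topspace K))) t"
      using assms(4) by (cases "t \<in> topspace K") (simp_all add: f(2) g(2), simp_all add: k_def)
  qed
  then show ?thesis
    using k unfolding C0_unitization_def by blast
qed

lemma C0_imp_unitization: "f \<in> C0 K \<Longrightarrow> f \<in> C0_unitization K"
proof -
  assume "f \<in> C0 K"
  moreover have "f = f + fscale 0 (indicator (topspace K))"
    by (simp add: fun_eq_iff)
  ultimately show ?thesis
    unfolding C0_unitization_def by blast
qed

lemma unit_in_unitization: "indicator (topspace K) \<in> C0_unitization K"
proof -
  have "indicator (topspace K) = 0 + fscale 1 (indicator (topspace K))"
    by (simp add: fun_eq_iff)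
  then show ?thesis
    using C0_zero unfolding C0_unitization_def by blast
qed

lemma unitization_bounded:
  assumes "a \<in> C0_unitization K"
  shows "bounded (range a)"
proof -
  obtain f c where f: "f \<in> C0 K" "a = f + fscale c (indicator (topspace K))"
    using assms by (auto simp: C0_unitization_def)
  obtain M where M: "\<And>t. cmod (f t) \<le> M"
    using C0_bounded[OF f(1)] by (auto simp: bounded_iff)
  have "cmod (a t) \<le> M + cmod c" for t
  proof -
    have "cmod (a t) \<le> cmod (f t) + cmod (c * indicator (topspace K) t)"
      unfolding f(2) by (simp add: norm_triangle_ineq)
    also have "\<dots> \<le> M + cmod c"
      using M by (intro add_mono) (auto simp: indicator_def)
    finally show ?thesis .
  qed
  then show ?thesis
    by (auto simp: bounded_iff)
qed

section \<open>The universal representation\<close>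

text \<open>\<open>mult_dominated\<close> says that M w*w - (aw)*(aw) is positive, with its square
  root \<open>c\<close> in the algebra. Positivity of a state then bounds multiplication by
  \<open>a\<close> in its GNS seminorm.\<close>

locale star_function_algebra =
  fixes A :: "('k \<Rightarrow> complex) set"
  assumes zero_closed: "0 \<in> A"
    and add_closed: "a \<in> A \<Longrightarrow> b \<in> A \<Longrightarrow> a + b \<in> A"
    and fscale_closed: "a \<in> A \<Longrightarrow> fscale c a \<in> A"
    and mult_closed: "a \<in> A \<Longrightarrow> b \<in> A \<Longrightarrow> a * b \<in> A"
    and finner_closed: "a \<in> A \<Longrightarrow> b \<in> A \<Longrightarrow> finner a b \<in> A"
    and mult_dominated: "a \<in> A \<Longrightarrow> \<exists>M\<ge>0. \<forall>w\<in>A. \<exists>c\<in>A.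
      fscale (of_real M) (finner w w) = finner (a * w) (a * w) + finner c c"

lemma star_function_algebra_unitization: "star_function_algebra (C0_unitization K)"
proof
  show "0 \<in> C0_unitization K"
    using C0_zero by (rule C0_imp_unitization)
  fix a b :: "'a \<Rightarrow> complex" assume a: "a \<in> C0_unitization K" and b: "b \<in> C0_unitization K"
  show "a + b \<in> C0_unitization K"
    using unitization_comp2[OF a b, of "(+)"] by (simp add: plus_fun_def continuous_on_complex_pair)
  show "a * b \<in> C0_unitization K"
    using unitization_comp2[OF a b, of "(*)"] by (simp add: times_fun_def continuous_on_complex_pair)
  have "continuous_on UNIV (\<lambda>p :: complex \<times> complex. cnj (fst p) * snd p)"
    by (intro continuous_intros)
  then show "finner a b \<in> C0_unitization K"
    using unitization_comp2[OF a b, of "\<lambda>z w. cnj z * w"] by (simp add: finner_def)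
next
  fix a :: "'a \<Rightarrow> complex" and c assume a: "a \<in> C0_unitization K"
  show "fscale c a \<in> C0_unitization K"
    using unitization_comp2[OF a a, of "\<lambda>z w. c * z"] by (simp add: fscale_def continuous_on_complex_pair)
next
  fix a :: "'a \<Rightarrow> complex" assume a: "a \<in> C0_unitization K"
  obtain B where B: "\<And>t. cmod (a t) \<le> B"
    using unitization_bounded[OF a] by (auto simp: bounded_iff)
  have "\<exists>c \<in> C0_unitization K.
      fscale (of_real (B\<^sup>2)) (finner w w) = finner (a * w) (a * w) + finner c c"
    if w: "w \<in> C0_unitization K" for w
  proof
    \<comment> \<open>The square root of (B^2 - |a|^2) w*w. The real function \<open>sqrt\<close> is
      total and continuous on the whole line, so the corresponding \<open>h\<close> is continuous
      everywhere, and the factor w makes it vanish at the origin.\<close>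
    define c where "c = (\<lambda>t. of_real (sqrt (B\<^sup>2 - (cmod (a t))\<^sup>2)) * w t)"
    have "continuous_on UNIV
        (\<lambda>p :: complex \<times> complex. of_real (sqrt (B\<^sup>2 - (cmod (fst p))\<^sup>2)) * snd p)"
      by (intro continuous_intros)
    then show "c \<in> C0_unitization K"
      unfolding c_def
      using unitization_comp2[OF a w, of "\<lambda>z w. of_real (sqrt (B\<^sup>2 - (cmod z)\<^sup>2)) * w"] by simp
    show "fscale (of_real (B\<^sup>2)) (finner w w) = finner (a * w) (a * w) + finner c c"
    proof
      fix t
      have "(cmod (a t))\<^sup>2 \<le> B\<^sup>2"
        using B[of t] by (intro power_mono) auto
      then have 1: "finner c c t = of_real (B\<^sup>2 - (cmod (a t))\<^sup>2) * (cnj (w t) * w t)"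
        by (simp add: c_def mult_ac power2_eq_square[symmetric]
            flip: of_real_mult of_real_power of_real_diff mult.assoc)
      have 2: "finner (a * w) (a * w) t = of_real ((cmod (a t))\<^sup>2) * (cnj (w t) * w t)"
        unfolding complex_norm_square by (simp add: mult_ac)
      show "fscale (of_real (B\<^sup>2)) (finner w w) t = (finner (a * w) (a * w) + finner c c) t"
        unfolding plus_fun_apply 1 2 by (simp add: left_diff_distrib)
    qed
  qed
  then show "\<exists>M\<ge>0. \<forall>w\<in>C0_unitization K. \<exists>c\<in>C0_unitization K.
      fscale (of_real M) (finner w w) = finner (a * w) (a * w) + finner c c"
    by (intro exI[of _ "B\<^sup>2"]) auto
qed

context star_function_algebra
begin

section \<open>The semi-inner product on finitely supported families\<close>

lemma univ_pre_support:
  assumes "u \<in> univ_pre A"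
  shows "finite {\<phi>. u \<phi> \<noteq> 0}" "{\<phi>. u \<phi> \<noteq> 0} \<subseteq> states A" "u \<phi> \<in> A"
  using assms by (auto simp: univ_pre_def)

lemma univ_pre_zero: "0 \<in> univ_pre A"
  by (simp add: univ_pre_def zero_closed)

lemma univ_pre_add:
  assumes u: "u \<in> univ_pre A" and v: "v \<in> univ_pre A"
  shows "u + v \<in> univ_pre A"
proof -
  have "{\<phi>. (u + v) \<phi> \<noteq> 0} \<subseteq> {\<phi>. u \<phi> \<noteq> 0} \<union> {\<phi>. v \<phi> \<noteq> 0}"
    by auto
  then have "finite {\<phi>. (u + v) \<phi> \<noteq> 0}" "{\<phi>. (u + v) \<phi> \<noteq> 0} \<subseteq> states A"
    using univ_pre_support(1,2)[OF u] univ_pre_support(1,2)[OF v]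
    by (auto dest: finite_subset simp del: plus_fun_apply)
  then show ?thesis
    using univ_pre_support(3)[OF u] univ_pre_support(3)[OF v]
    by (simp add: univ_pre_def add_closed)
qed

lemma univ_pre_mult:
  assumes a: "a \<in> A" and u: "u \<in> univ_pre A"
  shows "(\<lambda>\<phi>. a * u \<phi>) \<in> univ_pre A"
proof -
  have "{\<phi>. a * u \<phi> \<noteq> 0} \<subseteq> {\<phi>. u \<phi> \<noteq> 0}"
    by auto
  then have "finite {\<phi>. a * u \<phi> \<noteq> 0}" "{\<phi>. a * u \<phi> \<noteq> 0} \<subseteq> states A"
    using univ_pre_support(1,2)[OF u] by (auto dest: finite_subset)
  then show ?thesis
    using univ_pre_support(3)[OF u] a by (simp add: univ_pre_def mult_closed)
qed

lemma univ_pre_fscale: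
  assumes u: "u \<in> univ_pre A"
  shows "(\<lambda>\<phi>. fscale c (u \<phi>)) \<in> univ_pre A"
proof -
  have "{\<phi>. fscale c (u \<phi>) \<noteq> 0} \<subseteq> {\<phi>. u \<phi> \<noteq> 0}"
    by (auto simp: fscale_def zero_fun_def)
  then have "finite {\<phi>. fscale c (u \<phi>) \<noteq> 0}" "{\<phi>. fscale c (u \<phi>) \<noteq> 0} \<subseteq> states A"
    using univ_pre_support(1,2)[OF u] by (auto dest: finite_subset)
  then show ?thesis
    using univ_pre_support(3)[OF u] by (simp add: univ_pre_def fscale_closed)
qed

lemma diff_eq_add_fscale:
  fixes u v :: "'k family"
  shows "u - v = u + (\<lambda>\<phi>. fscale (- 1) (v \<phi>))"
  by (simp add: fun_eq_iff)

lemma univ_pre_diff: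
  assumes "u \<in> univ_pre A" "v \<in> univ_pre A"
  shows "u - v \<in> univ_pre A"
  unfolding diff_eq_add_fscale using assms by (intro univ_pre_add univ_pre_fscale)

text \<open>The form is defined by a sum over the common support, which can shrink when families are
  added. Enlarging the index set lets both sides of an identity be summed over the same
  states.\<close>

lemma univ_form_eq_sum:
  assumes "finite S" "S \<subseteq> states A" "{\<phi>. u \<phi> \<noteq> 0 \<and> v \<phi> \<noteq> 0} \<subseteq> S"
  shows "univ_form u v = (\<Sum>\<phi>\<in>S. \<phi> (finner (u \<phi>) (v \<phi>)))"
  unfolding univ_form_def
proof (rule sum.mono_neutral_left)
  show "\<forall>\<phi>\<in>S - {\<phi>. u \<phi> \<noteq> 0 \<and> v \<phi> \<noteq> 0}. \<phi> (finner (u \<phi>) (v \<phi>)) = 0"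
  proof
    fix \<phi> assume \<phi>: "\<phi> \<in> S - {\<phi>. u \<phi> \<noteq> 0 \<and> v \<phi> \<noteq> 0}"
    then have "finner (u \<phi>) (v \<phi>) = 0"
      by (auto simp: fun_eq_iff)
    then show "\<phi> (finner (u \<phi>) (v \<phi>)) = 0"
      using \<phi> assms(2) state_zero[OF _ zero_closed] by auto
  qed
qed (use assms in auto)

lemma univ_form_add_left:
  assumes "u \<in> univ_pre A" "u' \<in> univ_pre A" "v \<in> univ_pre A"
  shows "univ_form (u + u') v = univ_form u v + univ_form u' v"
proof -
  let ?S = "{\<phi>. v \<phi> \<noteq> 0}"
  note S = univ_pre_support(1,2)[OF assms(3)]
  have form: "univ_form w v = (\<Sum>\<phi>\<in>?S. \<phi> (finner (w \<phi>) (v \<phi>)))" for w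
    using S by (intro univ_form_eq_sum) auto
  have add: "\<phi> (finner ((u + u') \<phi>) (v \<phi>)) = \<phi> (finner (u \<phi>) (v \<phi>)) + \<phi> (finner (u' \<phi>) (v \<phi>))"
    if "\<phi> \<in> ?S" for \<phi>
  proof -
    have "finner ((u + u') \<phi>) (v \<phi>) = finner (u \<phi>) (v \<phi>) + finner (u' \<phi>) (v \<phi>)"
      by (simp add: fun_eq_iff algebra_simps)
    moreover have "\<phi> \<in> states A"
      using that S(2) by blast
    ultimately show ?thesis
      using univ_pre_support(3)[OF assms(1)] univ_pre_support(3)[OF assms(2)]
        univ_pre_support(3)[OF assms(3)]
      by (simp only: state_add finner_closed)
  qed
  show ?thesis
    unfolding form sum.distrib[symmetric] by (rule sum.cong[OF refl add])
qed

lemma univ_form_add_right: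
  assumes "u \<in> univ_pre A" "v \<in> univ_pre A" "v' \<in> univ_pre A"
  shows "univ_form u (v + v') = univ_form u v + univ_form u v'"
proof -
  let ?S = "{\<phi>. u \<phi> \<noteq> 0}"
  note S = univ_pre_support(1,2)[OF assms(1)]
  have form: "univ_form u w = (\<Sum>\<phi>\<in>?S. \<phi> (finner (u \<phi>) (w \<phi>)))" for w
    using S by (intro univ_form_eq_sum) auto
  have add: "\<phi> (finner (u \<phi>) ((v + v') \<phi>)) = \<phi> (finner (u \<phi>) (v \<phi>)) + \<phi> (finner (u \<phi>) (v' \<phi>))"
    if "\<phi> \<in> ?S" for \<phi>
  proof -
    have "finner (u \<phi>) ((v + v') \<phi>) = finner (u \<phi>) (v \<phi>) + finner (u \<phi>) (v' \<phi>)"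
      by (simp add: fun_eq_iff algebra_simps)
    moreover have "\<phi> \<in> states A"
      using that S(2) by blast
    ultimately show ?thesis
      using univ_pre_support(3)[OF assms(1)] univ_pre_support(3)[OF assms(2)]
        univ_pre_support(3)[OF assms(3)]
      by (simp only: state_add finner_closed)
  qed
  show ?thesis
    unfolding form sum.distrib[symmetric] by (rule sum.cong[OF refl add])
qed

lemma univ_form_fscale_left:
  assumes "u \<in> univ_pre A" "v \<in> univ_pre A"
  shows "univ_form (\<lambda>\<phi>. fscale c (u \<phi>)) v = cnj c * univ_form u v"
proof -
  let ?S = "{\<phi>. v \<phi> \<noteq> 0}"
  note S = univ_pre_support(1,2)[OF assms(2)]
  have "univ_form w v = (\<Sum>\<phi>\<in>?S. \<phi> (finner (w \<phi>) (v \<phi>)))" for w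
    using S by (intro univ_form_eq_sum) auto
  moreover have "\<phi> (finner (fscale c (u \<phi>)) (v \<phi>)) = cnj c * \<phi> (finner (u \<phi>) (v \<phi>))"
    if "\<phi> \<in> ?S" for \<phi>
  proof -
    have "finner (fscale c (u \<phi>)) (v \<phi>) = fscale (cnj c) (finner (u \<phi>) (v \<phi>))"
      by (simp add: fun_eq_iff)
    moreover have "\<phi> \<in> states A"
      using that S(2) by blast
    ultimately show ?thesis
      using univ_pre_support(3)[OF assms(1)] univ_pre_support(3)[OF assms(2)]
      by (simp only: state_fscale finner_closed)
  qed
  ultimately show ?thesis
    by (simp add: sum_distrib_left)
qed

lemma univ_form_fscale_right:
  assumes "u \<in> univ_pre A" "v \<in> univ_pre A"
  shows "univ_form u (\<lambda>\<phi>. fscale c (v \<phi>)) = c * univ_form u v"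
proof -
  let ?S = "{\<phi>. u \<phi> \<noteq> 0}"
  note S = univ_pre_support(1,2)[OF assms(1)]
  have "univ_form u w = (\<Sum>\<phi>\<in>?S. \<phi> (finner (u \<phi>) (w \<phi>)))" for w
    using S by (intro univ_form_eq_sum) auto
  moreover have "\<phi> (finner (u \<phi>) (fscale c (v \<phi>))) = c * \<phi> (finner (u \<phi>) (v \<phi>))"
    if "\<phi> \<in> ?S" for \<phi>
  proof -
    have "finner (u \<phi>) (fscale c (v \<phi>)) = fscale c (finner (u \<phi>) (v \<phi>))"
      by (simp add: fun_eq_iff)
    moreover have "\<phi> \<in> states A"
      using that S(2) by blast
    ultimately show ?thesis
      using univ_pre_support(3)[OF assms(1)] univ_pre_support(3)[OF assms(2)]
      by (simp only: state_fscale finner_closed)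
  qed
  ultimately show ?thesis
    by (simp add: sum_distrib_left)
qed

lemma univ_form_diff_left:
  assumes "u \<in> univ_pre A" "u' \<in> univ_pre A" "v \<in> univ_pre A"
  shows "univ_form (u - u') v = univ_form u v - univ_form u' v"
  unfolding diff_eq_add_fscale
  using assms by (simp add: univ_form_add_left univ_pre_fscale univ_form_fscale_left)

lemma univ_form_diff_right:
  assumes "u \<in> univ_pre A" "v \<in> univ_pre A" "v' \<in> univ_pre A"
  shows "univ_form u (v - v') = univ_form u v - univ_form u v'"
  unfolding diff_eq_add_fscale
  using assms by (simp add: univ_form_add_right univ_pre_fscale univ_form_fscale_right)

lemma univ_form_self_nonneg:
  assumes "u \<in> univ_pre A"
  shows "univ_form u u \<in> \<real>\<^sub>\<ge>\<^sub>0"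
proof -
  have "\<phi> (finner (u \<phi>) (u \<phi>)) \<in> \<real>\<^sub>\<ge>\<^sub>0" if "u \<phi> \<noteq> 0" for \<phi>
  proof -
    have "\<phi> \<in> states A"
      using that univ_pre_support(2)[OF assms] by blast
    then show ?thesis
      using univ_pre_support(3)[OF assms] by (rule state_finner_nonneg)
  qed
  then show ?thesis
    by (auto simp: univ_form_def complex_nonneg_Reals_iff intro!: sum_nonneg)
qed

lemma univ_form_expand:
  assumes "u \<in> univ_pre A" "v \<in> univ_pre A"
  shows "univ_form (u + (\<lambda>\<phi>. fscale c (v \<phi>))) (u + (\<lambda>\<phi>. fscale c (v \<phi>))) =
    univ_form u u + c * univ_form u v + cnj c * univ_form v u + of_real ((cmod c)\<^sup>2) * univ_form v v"
  unfolding complex_norm_square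
  using assms univ_pre_fscale[OF assms(2), of c]
  by (simp add: univ_form_add_left univ_form_add_right univ_pre_add univ_form_fscale_left
      univ_form_fscale_right algebra_simps)

text \<open>Hermitian symmetry is not part of the definition of a state; it follows by polarization,
  since the form of u + c v with itself is real for c = 1 and for c = \<i>.\<close>

lemma univ_form_cnj:
  assumes u: "u \<in> univ_pre A" and v: "v \<in> univ_pre A"
  shows "univ_form v u = cnj (univ_form u v)"
proof -
  have "Im (c * univ_form u v + cnj c * univ_form v u) = 0" for c
  proof -
    have "Im (univ_form (u + (\<lambda>\<phi>. fscale c (v \<phi>))) (u + (\<lambda>\<phi>. fscale c (v \<phi>)))) = 0"
      using univ_form_self_nonneg[OF univ_pre_add[OF u univ_pre_fscale[OF v]], of c]
      by (simp add: complex_nonneg_Reals_iff)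
    moreover have "Im (univ_form u u) = 0" "Im (univ_form v v) = 0"
      using univ_form_self_nonneg[OF u] univ_form_self_nonneg[OF v]
      by (simp_all add: complex_nonneg_Reals_iff)
    ultimately show ?thesis
      unfolding univ_form_expand[OF u v] by simp
  qed
  from this[of 1] this[of \<i>] show ?thesis
    by (simp add: complex_eq_iff)
qed

lemma univ_form_Cauchy_Schwarz:
  assumes u: "u \<in> univ_pre A" and v: "v \<in> univ_pre A"
  shows "cmod (univ_form u v) \<le> univ_seminorm u * univ_seminorm v"
proof -
  define b where "b = univ_form u v"
  define p where "p = Re (univ_form u u)"
  define r where "r = Re (univ_form v v)"
  have p: "univ_form u u = of_real p" "p \<ge> 0" and r: "univ_form v v = of_real r" "r \<ge> 0"
    using univ_form_self_nonneg[OF u] univ_form_self_nonneg[OF v]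
    by (auto simp: complex_nonneg_Reals_iff p_def r_def complex_eq_iff)
  have quad: "0 \<le> p - 2 * s * (cmod b)\<^sup>2 + s\<^sup>2 * (cmod b)\<^sup>2 * r" for s :: real
  proof -
    \<comment> \<open>This phase makes the cross terms real and equal to -s |b|^2 each. For r > 0
      the quadratic is minimal at s = 1/r.\<close>
    define c where "c = - of_real s * cnj b"
    have cb: "c * b = - of_real (s * (cmod b)\<^sup>2)"
      by (simp add: c_def complex_norm_square mult_ac del: of_real_power)
    have "univ_form (u + (\<lambda>\<phi>. fscale c (v \<phi>))) (u + (\<lambda>\<phi>. fscale c (v \<phi>))) =
        of_real p + c * b + cnj (c * b) + of_real ((cmod c)\<^sup>2) * of_real r"
      unfolding univ_form_expand[OF u v] univ_form_cnj[OF u v] p(1) r(1) by (simp add: b_def)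
    also have "\<dots> = of_real (p - 2 * s * (cmod b)\<^sup>2 + s\<^sup>2 * (cmod b)\<^sup>2 * r)"
      unfolding cb by (simp add: c_def norm_mult power_mult_distrib)
    finally show ?thesis
      using univ_form_self_nonneg[OF univ_pre_add[OF u univ_pre_fscale[OF v, of c]]]
      by (simp only: nonneg_Reals_of_real_iff)
  qed
  have "(cmod b)\<^sup>2 \<le> p * r"
  proof (cases "r = 0")
    case True
    have "b = 0"
    proof (rule ccontr)
      assume "b \<noteq> 0"
      then show False
        \<comment> \<open>For r = 0 the expression is affine in s, and this value of s makes it
          equal to -1.\<close>
        using quad[of "(p + 1) / (2 * (cmod b)\<^sup>2)"] True p(2) by (simp add: field_simps)
    qed
    then show ?thesis
      using p(2) r(2) by simp
  next
    case False
    then show ?thesis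
      using quad[of "1 / r"] r(2) by (simp add: field_simps power2_eq_square)
  qed
  then have "sqrt ((cmod b)\<^sup>2) \<le> sqrt (p * r)"
    by (rule real_sqrt_le_mono)
  then show ?thesis
    by (simp add: b_def p_def r_def univ_seminorm_def real_sqrt_mult)
qed

text \<open>\<open>mult_dominated\<close> is evaluated in every state and summed, which gives the
  constant sqrt(M). The bound is what makes multiplication by \<open>a\<close> compatible with
  passing to null sequences.\<close>

lemma univ_seminorm_mult_le:
  assumes "a \<in> A"
  shows "\<exists>M. \<forall>u \<in> univ_pre A. univ_seminorm (\<lambda>\<phi>. a * u \<phi>) \<le> M * univ_seminorm u"
proof -
  obtain M where M: "M \<ge> 0" "\<And>w. w \<in> A \<Longrightarrow> \<exists>c\<in>A.
      fscale (of_real M) (finner w w) = finner (a * w) (a * w) + finner c c"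
    using mult_dominated[OF assms] by blast
  have "univ_seminorm (\<lambda>\<phi>. a * u \<phi>) \<le> sqrt M * univ_seminorm u" if u: "u \<in> univ_pre A" for u
  proof -
    let ?S = "{\<phi>. u \<phi> \<noteq> 0}"
    note S = univ_pre_support(1,2)[OF u]
    have "Re (\<phi> (finner (a * u \<phi>) (a * u \<phi>))) \<le> M * Re (\<phi> (finner (u \<phi>) (u \<phi>)))"
      if "\<phi> \<in> ?S" for \<phi>
    proof -
      have \<phi>: "\<phi> \<in> states A"
        using that S(2) by blast
      have u\<phi>: "u \<phi> \<in> A"
        by (rule univ_pre_support(3)[OF u])
      obtain c where c: "c \<in> A"
        "fscale (of_real M) (finner (u \<phi>) (u \<phi>)) = finner (a * u \<phi>) (a * u \<phi>) + finner c c"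
        using M(2)[OF u\<phi>] by blast
      have "of_real M * \<phi> (finner (u \<phi>) (u \<phi>)) = \<phi> (fscale (of_real M) (finner (u \<phi>) (u \<phi>)))"
        using u\<phi> by (simp only: state_fscale[OF \<phi>] finner_closed)
      also have "\<dots> = \<phi> (finner (a * u \<phi>) (a * u \<phi>)) + \<phi> (finner c c)"
        unfolding c(2) using u\<phi> c(1) assms
        by (intro state_add[OF \<phi>] finner_closed mult_closed)
      finally have "Re (of_real M * \<phi> (finner (u \<phi>) (u \<phi>))) =
          Re (\<phi> (finner (a * u \<phi>) (a * u \<phi>)) + \<phi> (finner c c))"
        by (rule arg_cong)
      then have "M * Re (\<phi> (finner (u \<phi>) (u \<phi>))) =
          Re (\<phi> (finner (a * u \<phi>) (a * u \<phi>))) + Re (\<phi> (finner c c))"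
        by simp
      moreover have "Re (\<phi> (finner c c)) \<ge> 0"
        using state_finner_nonneg[OF \<phi> c(1)] by (simp add: complex_nonneg_Reals_iff)
      ultimately show ?thesis
        by linarith
    qed
    then have "(\<Sum>\<phi>\<in>?S. Re (\<phi> (finner (a * u \<phi>) (a * u \<phi>)))) \<le>
        M * (\<Sum>\<phi>\<in>?S. Re (\<phi> (finner (u \<phi>) (u \<phi>))))"
      by (auto simp: sum_distrib_left intro!: sum_mono)
    moreover have "univ_form (\<lambda>\<phi>. a * u \<phi>) (\<lambda>\<phi>. a * u \<phi>) =
        (\<Sum>\<phi>\<in>?S. \<phi> (finner (a * u \<phi>) (a * u \<phi>)))"
      using S by (intro univ_form_eq_sum) auto
    moreover have "univ_form u u = (\<Sum>\<phi>\<in>?S. \<phi> (finner (u \<phi>) (u \<phi>)))"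
      using S by (intro univ_form_eq_sum) auto
    ultimately have "Re (univ_form (\<lambda>\<phi>. a * u \<phi>) (\<lambda>\<phi>. a * u \<phi>)) \<le> M * Re (univ_form u u)"
      by simp
    then show ?thesis
      unfolding univ_seminorm_def real_sqrt_mult[symmetric] by (rule real_sqrt_le_mono)
  qed
  then show ?thesis
    by blast
qed

section \<open>Vectors of the completion given by constant sequences\<close>

lemma univ_seminorm_zero [simp]: "univ_seminorm 0 = 0"
  by (simp add: univ_seminorm_def univ_form_def)

text \<open>The canonical map of the algebraic direct sum into its completion.\<close>

definition univ_vec :: "'k family \<Rightarrow> 'k uvec" where
  "univ_vec e = univ_rel A `` {\<lambda>_. e}"

lemma const_univ_cauchy: "e \<in> univ_pre A \<Longrightarrow> (\<lambda>_. e) \<in> univ_cauchy A"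
  by (simp add: univ_cauchy_def)

lemma univ_rel_refl: "u \<in> univ_cauchy A \<Longrightarrow> (u, u) \<in> univ_rel A"
  by (simp add: univ_rel_def)

lemma univ_vec_in_space: "e \<in> univ_pre A \<Longrightarrow> univ_vec e \<in> univ_space A"
  unfolding univ_vec_def univ_space_def by (intro quotientI const_univ_cauchy)

text \<open>Operations on classes are unions over representatives; without a representative such a
  union would be empty instead of a class.\<close>

lemma univ_space_nonempty: "\<xi> \<in> univ_space A \<Longrightarrow> \<xi> \<noteq> {}"
  unfolding univ_space_def by (auto elim!: quotientE dest: univ_rel_refl)

lemma univ_scale_0:
  assumes "\<xi> \<in> univ_space A"
  shows "univ_scale A 0 \<xi> = univ_vec 0"
proof -
  have "(\<lambda>(n :: nat) \<phi>. fscale 0 (u n \<phi>)) = (\<lambda>_. 0)" for u :: "nat \<Rightarrow> 'k family"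
    by (simp add: fun_eq_iff)
  then show ?thesis
    using univ_space_nonempty[OF assms] by (simp add: univ_scale_def univ_vec_def)
qed

lemma univ_rep_0:
  assumes "\<xi> \<in> univ_space A"
  shows "univ_rep A 0 \<xi> = univ_vec 0"
proof -
  have "(\<lambda>(n :: nat) \<phi>. 0 * u n \<phi>) = (\<lambda>_. 0)" for u :: "nat \<Rightarrow> 'k family"
    by (simp add: fun_eq_iff)
  then show ?thesis
    using univ_space_nonempty[OF assms] by (simp add: univ_rep_def univ_vec_def)
qed

text \<open>Homogeneity at the scalar 0 suffices. The lemma makes the zero vectors that pad a
  sequence contribute nothing.\<close>

lemma univ_bounded_op_zero:
  assumes "univ_bounded_op A T"
  shows "T (univ_vec 0) = univ_vec 0"
proof -
  have 0: "univ_vec 0 \<in> univ_space A"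
    by (intro univ_vec_in_space univ_pre_zero)
  then have "T (univ_vec 0) = T (univ_scale A 0 (univ_vec 0))"
    by (simp add: univ_scale_0)
  also have "\<dots> = univ_scale A 0 (T (univ_vec 0))"
    using assms 0 by (simp add: univ_bounded_op_def)
  also have "\<dots> = univ_vec 0"
    using assms 0 by (intro univ_scale_0) (auto simp: univ_bounded_op_def)
  finally show ?thesis .
qed

text \<open>\<open>univ_inner\<close> is a definite description quantifying over all
  representatives, so convergence has to be shown for every pair of them; the pair of constant
  sequences then settles uniqueness.\<close>

lemma univ_inner_rep:
  assumes a: "a \<in> A" and e: "e \<in> univ_pre A" and e': "e' \<in> univ_pre A"
  shows "univ_inner (univ_vec e') (univ_rep A a (univ_vec e)) = univ_form e' (\<lambda>\<phi>. a * e \<phi>)"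
  unfolding univ_inner_def
proof (rule the_equality)
  let ?ae = "\<lambda>\<phi>. a * e \<phi>"
  have ae: "?ae \<in> univ_pre A"
    using a e by (rule univ_pre_mult)
  obtain M where M: "\<And>u. u \<in> univ_pre A \<Longrightarrow> univ_seminorm (\<lambda>\<phi>. a * u \<phi>) \<le> M * univ_seminorm u"
    using univ_seminorm_mult_le[OF a] by blast
  show "\<forall>u\<in>univ_vec e'. \<forall>v\<in>univ_rep A a (univ_vec e).
      (\<lambda>n. univ_form (u n) (v n)) \<longlonglongrightarrow> univ_form e' ?ae"
  proof (intro ballI)
    fix u v assume "u \<in> univ_vec e'" and "v \<in> univ_rep A a (univ_vec e)"
    then obtain w where w: "w \<in> univ_vec e" and vw: "(\<lambda>n \<phi>. a * w n \<phi>, v) \<in> univ_rel A"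
      by (auto simp: univ_rep_def)
    have u: "u n \<in> univ_pre A" "(\<lambda>n. univ_seminorm (e' - u n)) \<longlonglongrightarrow> 0" for n
      using \<open>u \<in> univ_vec e'\<close>
      unfolding univ_vec_def univ_rel_def univ_cauchy_def by blast+
    have w': "w n \<in> univ_pre A" "(\<lambda>n. univ_seminorm (e - w n)) \<longlonglongrightarrow> 0" for n
      using w unfolding univ_vec_def univ_rel_def univ_cauchy_def by blast+
    have v: "v n \<in> univ_pre A"
      and vw_lim: "(\<lambda>n. univ_seminorm ((\<lambda>\<phi>. a * w n \<phi>) - v n)) \<longlonglongrightarrow> 0" for n
      using vw unfolding univ_rel_def univ_cauchy_def by blast+
    define x where "x n = ?ae - v n" for n
    define y where "y n = e' - u n" for n
    have x: "x n \<in> univ_pre A" and y: "y n \<in> univ_pre A" for n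
      unfolding x_def y_def by (intro univ_pre_diff ae v e' u(1))+
    have x_bound: "cmod (univ_form z (x n)) \<le>
        univ_seminorm z * (M * univ_seminorm (e - w n) + univ_seminorm ((\<lambda>\<phi>. a * w n \<phi>) - v n))"
      if z: "z \<in> univ_pre A" for z n
    proof -
      \<comment> \<open>A member \<open>v\<close> of the image class is only equivalent to a w for
        some representative \<open>w\<close> of \<open>e\<close>. The error thus has two parts, a (e
        - w) and a w - v, and the first needs boundedness of multiplication.\<close>
      let ?p = "\<lambda>\<phi>. a * (e - w n) \<phi>" and ?q = "(\<lambda>\<phi>. a * w n \<phi>) - v n"
      have p: "?p \<in> univ_pre A" and q: "?q \<in> univ_pre A"
        by (intro univ_pre_mult univ_pre_diff a e w' v)+
      have "x n = ?p + ?q"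
        by (simp add: x_def fun_eq_iff algebra_simps)
      then have "cmod (univ_form z (x n)) \<le> cmod (univ_form z ?p) + cmod (univ_form z ?q)"
        by (simp only: univ_form_add_right[OF z p q] norm_triangle_ineq)
      also have "\<dots> \<le> univ_seminorm z * univ_seminorm ?p + univ_seminorm z * univ_seminorm ?q"
        by (intro add_mono univ_form_Cauchy_Schwarz z p q)
      also have "\<dots> \<le> univ_seminorm z * (M * univ_seminorm (e - w n)) +
          univ_seminorm z * univ_seminorm ?q"
        using univ_form_self_nonneg[OF z]
        by (intro add_right_mono mult_left_mono M univ_pre_diff e w')
          (auto simp: univ_seminorm_def complex_nonneg_Reals_iff)
      finally show ?thesis
        by (simp add: algebra_simps)
    qed
    \<comment> \<open>The expansion of the form of e' - y and ae - x; by Cauchy-Schwarz every term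
      containing a null sequence disappears.\<close>
    have "(\<lambda>n. univ_form e' ?ae - univ_form (y n) ?ae - univ_form e' (x n) + univ_form (y n) (x n))
        \<longlonglongrightarrow> univ_form e' ?ae - 0 - 0 + 0"
    proof (intro tendsto_intros)
      have y0: "(\<lambda>n. univ_seminorm (y n)) \<longlonglongrightarrow> 0"
        using u(2) by (simp add: y_def)
      have "(\<lambda>n. univ_seminorm (y n) * univ_seminorm ?ae) \<longlonglongrightarrow> 0"
        using y0 by (rule tendsto_mult_left_zero)
      then show "(\<lambda>n. univ_form (y n) ?ae) \<longlonglongrightarrow> 0"
        by (rule Lim_null_comparison[rotated]) (intro always_eventually allI univ_form_Cauchy_Schwarz y ae)
      have "(\<lambda>n. M * univ_seminorm (e - w n) + univ_seminorm ((\<lambda>\<phi>. a * w n \<phi>) - v n)) \<longlonglongrightarrow> M * 0 + 0"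
        by (intro tendsto_add tendsto_mult tendsto_const w'(2) vw_lim)
      then have r0: "(\<lambda>n. M * univ_seminorm (e - w n) + univ_seminorm ((\<lambda>\<phi>. a * w n \<phi>) - v n)) \<longlonglongrightarrow> 0"
        by simp
      from tendsto_mult_right_zero[OF r0, of "univ_seminorm e'"]
      show "(\<lambda>n. univ_form e' (x n)) \<longlonglongrightarrow> 0"
        by (rule Lim_null_comparison[rotated]) (intro always_eventually allI x_bound e')
      from tendsto_mult_zero[OF y0 r0]
      show "(\<lambda>n. univ_form (y n) (x n)) \<longlonglongrightarrow> 0"
        by (rule Lim_null_comparison[rotated]) (intro always_eventually allI x_bound y)
    qed
    moreover have "univ_form (u n) (v n) =
        univ_form e' ?ae - univ_form (y n) ?ae - univ_form e' (x n) + univ_form (y n) (x n)" for n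
      unfolding x_def y_def
      by (simp add: univ_form_diff_left univ_form_diff_right univ_pre_diff e' ae u(1) v)
    ultimately show "(\<lambda>n. univ_form (u n) (v n)) \<longlonglongrightarrow> univ_form e' ?ae"
      by simp
  qed
  fix c assume c: "\<forall>u\<in>univ_vec e'. \<forall>v\<in>univ_rep A a (univ_vec e).
      (\<lambda>n. univ_form (u n) (v n)) \<longlonglongrightarrow> c"
  have "(\<lambda>_. e') \<in> univ_vec e'"
    unfolding univ_vec_def using univ_rel_refl[OF const_univ_cauchy[OF e']] by simp
  moreover have "(\<lambda>_. ?ae) \<in> univ_rep A a (univ_vec e)"
  proof -
    have "(\<lambda>_. e) \<in> univ_vec e"
      unfolding univ_vec_def using univ_rel_refl[OF const_univ_cauchy[OF e]] by simp
    then show ?thesis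
      unfolding univ_rep_def using univ_rel_refl[OF const_univ_cauchy[OF ae]] by blast
  qed
  ultimately have "(\<lambda>_ :: nat. univ_form e' ?ae) \<longlonglongrightarrow> c"
    using c by fastforce
  then show "c = univ_form e' ?ae"
    by (simp add: LIMSEQ_const_iff)
qed

lemma univ_inner_zero_rep:
  assumes "a \<in> A"
  shows "univ_inner (univ_vec 0) (univ_rep A a (univ_vec 0)) = 0"
  using univ_inner_rep[OF assms univ_pre_zero univ_pre_zero] by (simp add: univ_form_def)

lemma univ_inner_zero: "univ_inner (univ_vec 0) (univ_vec 0) = 0"
  using univ_inner_zero_rep[OF zero_closed] univ_rep_0[OF univ_vec_in_space[OF univ_pre_zero]]
  by simp

text \<open>The vector functionals of the ultraweak topology are recovered by testing against square
  summable sequences that vanish from the second entry on.\<close>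

lemma ultraweak_tendsto_inner:
  assumes "ultraweak_tendsto A (\<lambda>i. univ_rep A (f i)) T G" "univ_bounded_op A T"
    and "\<forall>\<^sub>F i in G. f i \<in> A" and e: "e \<in> univ_pre A"
  shows "((\<lambda>i. univ_form e (\<lambda>\<phi>. f i * e \<phi>)) \<longlongrightarrow> univ_inner (univ_vec e) (T (univ_vec e))) G"
proof -
  define \<xi> where "\<xi> n = (if n = (0 :: nat) then univ_vec e else univ_vec 0)" for n
  have "range \<xi> \<subseteq> univ_space A"
    using e univ_pre_zero by (auto simp: \<xi>_def intro: univ_vec_in_space)
  moreover have "summable (\<lambda>n. (univ_norm (\<xi> n))\<^sup>2)"
    by (rule summable_finite[of "{0}"]) (auto simp: \<xi>_def univ_norm_def univ_inner_zero)
  ultimately have lim: "((\<lambda>i. \<Sum>n. univ_inner (\<xi> n) (univ_rep A (f i) (\<xi> n))) \<longlongrightarrow>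
      (\<Sum>n. univ_inner (\<xi> n) (T (\<xi> n)))) G"
    using assms(1) unfolding ultraweak_tendsto_def by blast
  have "(\<Sum>n. univ_inner (\<xi> n) (T (\<xi> n))) = (\<Sum>n\<in>{0}. univ_inner (\<xi> n) (T (\<xi> n)))"
    by (rule suminf_finite)
      (auto simp: \<xi>_def univ_bounded_op_zero[OF assms(2)] univ_inner_zero)
  then have T: "(\<Sum>n. univ_inner (\<xi> n) (T (\<xi> n))) = univ_inner (univ_vec e) (T (univ_vec e))"
    by (simp add: \<xi>_def)
  have "\<forall>\<^sub>F i in G. (\<Sum>n. univ_inner (\<xi> n) (univ_rep A (f i) (\<xi> n))) =
      univ_form e (\<lambda>\<phi>. f i * e \<phi>)"
    using assms(3)
  proof eventually_elim
    case (elim i)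
    have "(\<Sum>n. univ_inner (\<xi> n) (univ_rep A (f i) (\<xi> n))) =
        (\<Sum>n\<in>{0}. univ_inner (\<xi> n) (univ_rep A (f i) (\<xi> n)))"
      by (rule suminf_finite) (auto simp: \<xi>_def univ_inner_zero_rep[OF elim])
    then show ?case
      using univ_inner_rep[OF elim e e] by (simp add: \<xi>_def)
  qed
  then show ?thesis
    using lim unfolding T by (rule Lim_transform_eventually[rotated])
qed

end

section \<open>Frames\<close>

text \<open>Restricted to \<open>A\<close> because members of \<open>states A\<close> are
  extensional.\<close>

definition eval_state :: "('k \<Rightarrow> complex) set \<Rightarrow> 'k \<Rightarrow> ('k \<Rightarrow> complex) \<Rightarrow> complex" where
  "eval_state A t = (\<lambda>a\<in>A. a t)"

text \<open>The norm 1 is attained at the unit, which takes the value 1 at every point of the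
  space.\<close>

lemma eval_state_unitization:
  assumes "t \<in> topspace K"
  shows "eval_state (C0_unitization K) t \<in> states (C0_unitization K)"
proof -
  let ?A = "C0_unitization K" and ?\<phi> = "eval_state (C0_unitization K) t"
  interpret star_function_algebra ?A
    by (rule star_function_algebra_unitization)
  have le: "cmod (?\<phi> a) \<le> 1" if "a \<in> {a \<in> ?A. fnorm a \<le> 1}" for a
    using that cmod_le_fnorm[OF unitization_bounded, of a K t] by (simp add: eval_state_def)
  have unit: "indicator (topspace K) \<in> {a \<in> ?A. fnorm a \<le> 1}"
    by (auto simp: unit_in_unitization indicator_def intro!: fnorm_le)
  have bdd: "bdd_above ((\<lambda>a. cmod (?\<phi> a)) ` {a \<in> ?A. fnorm a \<le> 1})"
    using le by (rule bdd_aboveI2)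
  have "(SUP a \<in> {a \<in> ?A. fnorm a \<le> 1}. cmod (?\<phi> a)) = 1"
  proof (rule antisym)
    show "(SUP a \<in> {a \<in> ?A. fnorm a \<le> 1}. cmod (?\<phi> a)) \<le> 1"
      using unit le by (intro cSUP_least) auto
    have "1 = cmod (?\<phi> (indicator (topspace K)))"
      using assms by (simp add: eval_state_def unit_in_unitization)
    also have "\<dots> \<le> (SUP a \<in> {a \<in> ?A. fnorm a \<le> 1}. cmod (?\<phi> a))"
      using unit bdd by (rule cSUP_upper)
    finally show "1 \<le> (SUP a \<in> {a \<in> ?A. fnorm a \<le> 1}. cmod (?\<phi> a))" .
  qed
  moreover have "?\<phi> (finner a a) \<in> \<real>\<^sub>\<ge>\<^sub>0" if "a \<in> ?A" for a
    using that by (simp add: eval_state_def finner_closed complex_nonneg_Reals_iff)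
  ultimately show ?thesis
    using bdd by (simp add: states_def) (simp add: eval_state_def add_closed fscale_closed)
qed

text \<open>Both the limit and the order relation are evaluated at \<open>t\<close>. The conclusion
  has the same form as for ultraweak convergence, so that one argument excludes both kinds of
  frame.\<close>

lemma norm_frame_lower_bound:
  assumes "norm_tendsto (frame_sum finner xs x) s (finite_subsets_at_top J)"
    and "s \<in> C0_unitization K" "alg_le (C0_unitization K) (fscale c (finner x x)) s"
    and "\<And>j. j \<in> J \<Longrightarrow> xs j \<in> C0 K" "x \<in> C0 K"
  shows "\<exists>L. ((\<lambda>F. frame_sum finner xs x F t) \<longlongrightarrow> L) (finite_subsets_at_top J) \<and>
    L - c * finner x x t \<in> \<real>\<^sub>\<ge>\<^sub>0"
proof (intro exI conjI)
  have "\<forall>\<^sub>F F in finite_subsets_at_top J. bounded (range (frame_sum finner xs x F - s))"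
  proof (rule eventually_finite_subsets_at_top_weakI)
    fix F assume "finite F" "F \<subseteq> J"
    then have "frame_sum finner xs x F \<in> C0 K"
      unfolding frame_sum_def using assms(4,5)
      by (intro C0_sum C0_mult finner_C0_left C0_imp_Cb) auto
    then obtain B C where "\<And>t. cmod (frame_sum finner xs x F t) \<le> B" "\<And>t. cmod (s t) \<le> C"
      using C0_bounded unitization_bounded[OF assms(2)] by (meson bounded_iff rangeI)
    then have "cmod ((frame_sum finner xs x F - s) t) \<le> B + C" for t
      using norm_triangle_ineq4[of "frame_sum finner xs x F t" "s t"]
      by (simp add: add_mono order_trans)
    then show "bounded (range (frame_sum finner xs x F - s))"
      by (auto simp: bounded_iff simp del: fun_diff_def)
  qed
  with assms(1) show "((\<lambda>F. frame_sum finner xs x F t) \<longlongrightarrow> s t) (finite_subsets_at_top J)"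
    by (rule norm_tendsto_apply)
  obtain d where "s - fscale c (finner x x) = finner d d"
    using assms(3) by (auto simp: alg_le_def)
  then have "(s - fscale c (finner x x)) t = finner d d t"
    by (rule fun_cong)
  then show "s t - c * finner x x t \<in> \<real>\<^sub>\<ge>\<^sub>0"
    by (simp add: complex_nonneg_Reals_iff)
qed

lemma ultraweak_frame_lower_bound:
  assumes "ultraweak_tendsto (C0_unitization K)
      (\<lambda>F. univ_rep (C0_unitization K) (frame_sum finner xs x F)) T (finite_subsets_at_top J)"
    and "T \<in> enveloping_vN (C0_unitization K)"
    and "univ_op_le (C0_unitization K) (univ_rep (C0_unitization K) (fscale c (finner x x))) T"
    and "\<And>j. j \<in> J \<Longrightarrow> xs j \<in> C0 K" "x \<in> C0 K" "t \<in> topspace K"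
  shows "\<exists>L. ((\<lambda>F. frame_sum finner xs x F t) \<longlongrightarrow> L) (finite_subsets_at_top J) \<and>
    L - c * finner x x t \<in> \<real>\<^sub>\<ge>\<^sub>0"
proof -
  let ?A = "C0_unitization K" and ?\<phi> = "eval_state (C0_unitization K) t"
  interpret star_function_algebra ?A
    by (rule star_function_algebra_unitization)
  \<comment> \<open>The unit placed in the summand of the evaluation at \<open>t\<close>: its vector
    state sends the operator of \<open>a\<close> to a(t).\<close>
  define e :: "'a family" where "e \<psi> = (if \<psi> = ?\<phi> then indicator (topspace K) else 0)" for \<psi>
  have supp: "{\<psi>. e \<psi> \<noteq> 0} \<subseteq> {?\<phi>}"
    by (auto simp: e_def)
  then have e: "e \<in> univ_pre ?A"
    using eval_state_unitization[OF assms(6)] finite_subset[OF supp]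
    by (auto simp: univ_pre_def e_def unit_in_unitization zero_closed)
  have form: "univ_form e (\<lambda>\<psi>. a * e \<psi>) = a t" if "a \<in> ?A" for a
  proof -
    have "univ_form e (\<lambda>\<psi>. a * e \<psi>) = (\<Sum>\<psi>\<in>{?\<phi>}. \<psi> (finner (e \<psi>) (a * e \<psi>)))"
      using supp eval_state_unitization[OF assms(6)] by (intro univ_form_eq_sum) auto
    also have "\<dots> = finner (e ?\<phi>) (a * e ?\<phi>) t"
      using that by (simp add: eval_state_def e_def finner_closed mult_closed unit_in_unitization
          del: finner_apply)
    also have "\<dots> = a t"
      using assms(6) by (simp add: e_def)
    finally show ?thesis .
  qed
  have sums: "\<forall>\<^sub>F F in finite_subsets_at_top J. frame_sum finner xs x F \<in> ?A"
  proof (rule eventually_finite_subsets_at_top_weakI)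
    fix F assume "finite F" "F \<subseteq> J"
    then show "frame_sum finner xs x F \<in> ?A"
      unfolding frame_sum_def using assms(4,5)
      by (intro C0_imp_unitization C0_sum C0_mult finner_C0_left C0_imp_Cb) auto
  qed
  have op: "univ_bounded_op ?A T"
    using assms(2) by (simp add: enveloping_vN_def univ_commutant_def)
  let ?L = "univ_inner (univ_vec e) (T (univ_vec e))"
  have "((\<lambda>F. univ_form e (\<lambda>\<psi>. frame_sum finner xs x F * e \<psi>)) \<longlongrightarrow> ?L) (finite_subsets_at_top J)"
    using assms(1) op sums e by (rule ultraweak_tendsto_inner)
  then have "((\<lambda>F. frame_sum finner xs x F t) \<longlongrightarrow> ?L) (finite_subsets_at_top J)"
    by (rule Lim_transform_eventually) (use sums in eventually_elim, rule form)
  moreover have "?L - c * finner x x t \<in> \<real>\<^sub>\<ge>\<^sub>0"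
  proof -
    have x: "fscale c (finner x x) \<in> ?A"
      using assms(5) by (intro C0_imp_unitization C0_fscale finner_C0_left C0_imp_Cb)
    have "?L - univ_inner (univ_vec e) (univ_rep ?A (fscale c (finner x x)) (univ_vec e)) \<in> \<real>\<^sub>\<ge>\<^sub>0"
      using assms(3) univ_vec_in_space[OF e] by (simp add: univ_op_le_def)
    then show ?thesis
      unfolding univ_inner_rep[OF x e e] form[OF x] by simp
  qed
  ultimately show ?thesis
    by blast
qed

section \<open>Excluding frames\<close>

context sigma_precompact_clopen
begin

text \<open>Choose points \<open>q 0, q 1, \<dots>\<close> in \<open>A\<close> so that \<open>q n\<close> lies outside a compact set containing the
  supports of the countably many \<open>xs j\<close> that do not vanish at an earlier point.  Then no \<open>xs j\<close> is
  nonzero at two of the points, although finitely many of the sets \<open>{xs j \<noteq> 0}\<close> cover a compact set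
  containing all of them.\<close>

lemma no_point_countable_cover:
  assumes xs: "\<And>j. j \<in> J \<Longrightarrow> xs j \<in> C0 K"
    and count: "\<And>t. t \<in> A \<Longrightarrow> countable {j \<in> J. xs j t \<noteq> 0}"
    and cover: "\<And>t. t \<in> A \<Longrightarrow> \<exists>j\<in>J. xs j t \<noteq> 0"
  shows False
proof -
  have A_sub: "A \<subseteq> topspace K"
    by (rule openin_subset[OF openin])
  \<comment> \<open>One step of the recursion: \<open>D\<close> is the compact set reached so far,
    \<open>t\<close> a new point outside it, and \<open>E\<close> a larger compact set containing
    the part in \<open>A\<close> of every support that meets \<open>t\<close>.\<close>
  define good where "good D t E \<longleftrightarrow> t \<in> A - D \<and> compactin K E \<and> E \<subseteq> A \<and> D \<subseteq> E \<and>
      (\<forall>j\<in>J. xs j t \<noteq> 0 \<longrightarrow> (\<forall>s\<in>A. xs j s \<noteq> 0 \<longrightarrow> s \<in> E))" for D t E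
  have "\<exists>t E. good D t E" if D: "compactin K D" "D \<subseteq> A" for D
  proof -
    obtain t where t: "t \<in> A" "t \<notin> D"
      using D not_compact by (metis subsetI subset_antisym)
    have "countable (xs ` {j \<in> J. xs j t \<noteq> 0})" "xs ` {j \<in> J. xs j t \<noteq> 0} \<subseteq> C0 K"
      using count[OF t(1)] xs by auto
    then obtain E where E: "compactin K E" "E \<subseteq> A"
      "\<forall>f \<in> xs ` {j \<in> J. xs j t \<noteq> 0}. \<forall>s\<in>A. f s \<noteq> 0 \<longrightarrow> s \<in> E"
      using C0_countable_support by meson
    have "\<forall>j\<in>J. xs j t \<noteq> 0 \<longrightarrow> (\<forall>s\<in>A. xs j s \<noteq> 0 \<longrightarrow> s \<in> D \<union> E)"
      using E(3) by (simp add: Ball_image_comp)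
    then have "good D t (D \<union> E)"
      unfolding good_def using D(2) t E(2) compactin_Un[OF D(1) E(1)] by simp
    then show ?thesis
      by blast
  qed
  then obtain p E where pE: "\<And>D. compactin K D \<Longrightarrow> D \<subseteq> A \<Longrightarrow> good D (p D) (E D)"
    by metis
  define D where "D n = (E ^^ n) {}" for n
  define q where "q n = p (D n)" for n
  have D: "compactin K (D n) \<and> D n \<subseteq> A" for n
  proof (induction n)
    case (Suc n)
    then show ?case
      using pE[of "D n"] by (simp add: D_def good_def)
  qed (simp add: D_def)
  have good: "good (D n) (q n) (D (Suc n))" for n
    using pE[of "D n"] D[of n] by (simp add: D_def q_def)
  have step: "D n \<subseteq> D (Suc n)" and q: "q n \<in> A" "q n \<notin> D n"
    and catch: "\<And>j s. j \<in> J \<Longrightarrow> xs j (q n) \<noteq> 0 \<Longrightarrow> s \<in> A \<Longrightarrow> xs j s \<noteq> 0 \<Longrightarrow> s \<in> D (Suc n)" for n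
    using good[of n] unfolding good_def by blast+
  have D_mono: "D m \<subseteq> D n" if "m \<le> n" for m n
    using lift_Suc_mono_le[of D, OF step that] .
  \<comment> \<open>An element nonzero at \<open>q m\<close> has its nonzero points of
    \<open>A\<close> in \<open>D (Suc m)\<close>, hence in \<open>D n\<close>, which
    \<open>q n\<close> avoids.\<close>
  have later_zero: "xs j (q n) = 0" if "m < n" "j \<in> J" "xs j (q m) \<noteq> 0" for m n j
    using catch[OF that(2,3) q(1)] D_mono[of "Suc m" n] that(1) q(2) by (meson Suc_leI subsetD)
  \<comment> \<open>The sequence is a countable union of singletons, so the precompactness
    assumption applies to it as well.\<close>
  obtain C where C: "compactin K C" "C \<subseteq> A" "range q \<subseteq> C"
  proof -
    have "compactin K {q n}" "{q n} \<subseteq> A" for n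
      using q(1)[of n] A_sub by auto
    then obtain C where "compactin K C" "C \<subseteq> A" "(\<Union>n. {q n}) \<subseteq> C"
      using sigma_compact_bound[of "\<lambda>n. {q n}"] by blast
    then show thesis
      by (intro that[of C]) auto
  qed
  let ?U = "\<lambda>j. {t \<in> topspace K. xs j t \<noteq> 0}"
  have open_U: "\<forall>U \<in> ?U ` J. openin K U"
    using xs by (auto simp: C0_def intro!: openin_nonzero)
  have cover_U: "C \<subseteq> \<Union> (?U ` J)"
  proof
    fix t assume "t \<in> C"
    then have "t \<in> A" "t \<in> topspace K"
      using C(2) A_sub by auto
    then show "t \<in> \<Union> (?U ` J)"
      using cover[of t] by auto
  qed
  obtain \<F> where \<F>: "finite \<F>" "\<F> \<subseteq> ?U ` J" "C \<subseteq> \<Union>\<F>"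
    using C(1) open_U cover_U unfolding compactin_def by meson
  obtain J0 where J0: "finite J0" "J0 \<subseteq> J" "\<F> = ?U ` J0"
    using finite_subset_image[OF \<F>(1,2)] by blast
  have "\<exists>j\<in>J0. xs j (q n) \<noteq> 0" for n
    using \<F>(3) C(3) unfolding J0(3) by blast
  then obtain i where i: "\<And>n. i n \<in> J0" "\<And>n. xs (i n) (q n) \<noteq> 0"
    by metis
  have "i m \<noteq> i n" if "m < n" for m n
    using later_zero[OF that, of "i m"] i(1)[of m] i(2)[of m] i(2)[of n] J0(2) by auto
  then have "inj i"
    by (auto simp: inj_def) (metis linorder_neqE_nat)
  moreover have "range i \<subseteq> J0"
    using i(1) by blast
  ultimately have "finite (UNIV :: nat set)"
    using J0(1) by (meson finite_imageD finite_subset)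
  then show False
    by simp
qed

lemma no_pointwise_frame:
  assumes xs: "\<And>j. j \<in> J \<Longrightarrow> xs j \<in> C0 K" and c: "c > 0"
    and lim: "\<And>x t. x \<in> C0 K \<Longrightarrow> t \<in> A \<Longrightarrow>
      \<exists>L. ((\<lambda>F. frame_sum finner xs x F t) \<longlongrightarrow> L) (finite_subsets_at_top J) \<and>
        L - of_real c * finner x x t \<in> \<real>\<^sub>\<ge>\<^sub>0"
  shows False
proof -
  have *: "countable {j \<in> J. xs j t \<noteq> 0} \<and> (\<exists>j\<in>J. xs j t \<noteq> 0)" if t: "t \<in> A" for t
  proof -
    have "compactin K {t}"
      using t openin_subset[OF openin] by auto
    \<comment> \<open>With x(t) = 1 the frame sum at \<open>t\<close> is the sum of the |x_j(t)|^2
      itself. Its unconditional convergence gives countability, and L at least c > 0 excludes that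
      all terms vanish.\<close>
    then obtain x where x: "x \<in> C0 K" "x t = 1"
      using C0_bump[OF LCH] by blast
    obtain L where L: "((\<lambda>F. frame_sum finner xs x F t) \<longlongrightarrow> L) (finite_subsets_at_top J)"
      "L - of_real c \<in> \<real>\<^sub>\<ge>\<^sub>0"
      using lim[OF x(1) t] x(2) by auto
    have sum: "((\<lambda>j. xs j t * cnj (xs j t)) has_sum L) J"
      using L(1) by (simp add: has_sum_def frame_sum_def x(2))
    have "countable {j \<in> J. xs j t * cnj (xs j t) \<noteq> 0}"
      using sum by (intro summable_countable_complex) (auto simp: summable_on_def)
    moreover have "\<exists>j\<in>J. xs j t \<noteq> 0"
    proof (rule ccontr)
      assume "\<not> ?thesis"
      then have "((\<lambda>j. xs j t * cnj (xs j t)) has_sum 0) J"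
        by (intro has_sum_0) auto
      then have "L = 0"
        using sum has_sum_unique by blast
      then show False
        using L(2) c by (simp add: complex_nonneg_Reals_iff)
    qed
    ultimately show ?thesis
      by simp
  qed
  show False
  proof (rule no_point_countable_cover[OF xs])
    fix t assume "t \<in> A"
    then show "countable {j \<in> J. xs j t \<noteq> 0}" "\<exists>j\<in>J. xs j t \<noteq> 0"
      using * by blast+
  qed
qed

lemma no_frame:
  "\<not> (standard_frame (C0_unitization K) (C0 K) finner J xs \<or>
      nonstandard_frame (C0_unitization K) (C0 K) finner J xs)"
proof
  assume "standard_frame (C0_unitization K) (C0 K) finner J xs \<or>
      nonstandard_frame (C0_unitization K) (C0 K) finner J xs"
  then show False
  proof
    assume "standard_frame (C0_unitization K) (C0 K) finner J xs"
    then obtain c1 :: real where xs: "\<And>j. j \<in> J \<Longrightarrow> xs j \<in> C0 K" and c1: "c1 > 0"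
      and frame: "\<forall>x\<in>C0 K. \<exists>s\<in>C0_unitization K.
        norm_tendsto (frame_sum finner xs x) s (finite_subsets_at_top J) \<and>
        alg_le (C0_unitization K) (fscale (of_real c1) (finner x x)) s"
      unfolding standard_frame_def by blast
    show False
    proof (rule no_pointwise_frame[OF xs c1])
      fix x t assume x: "x \<in> C0 K"
      obtain s where s: "s \<in> C0_unitization K"
        "norm_tendsto (frame_sum finner xs x) s (finite_subsets_at_top J)"
        "alg_le (C0_unitization K) (fscale (of_real c1) (finner x x)) s"
        using frame x by blast
      show "\<exists>L. ((\<lambda>F. frame_sum finner xs x F t) \<longlongrightarrow> L) (finite_subsets_at_top J) \<and>
          L - of_real c1 * finner x x t \<in> \<real>\<^sub>\<ge>\<^sub>0"
        using s(2,1,3) xs x by (rule norm_frame_lower_bound)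
    qed
  next
    assume "nonstandard_frame (C0_unitization K) (C0 K) finner J xs"
    then obtain c1 :: real where xs: "\<And>j. j \<in> J \<Longrightarrow> xs j \<in> C0 K" and c1: "c1 > 0"
      and frame: "\<forall>x\<in>C0 K. \<exists>T\<in>enveloping_vN (C0_unitization K).
        ultraweak_tendsto (C0_unitization K)
          (\<lambda>F. univ_rep (C0_unitization K) (frame_sum finner xs x F)) T (finite_subsets_at_top J) \<and>
        univ_op_le (C0_unitization K)
          (univ_rep (C0_unitization K) (fscale (of_real c1) (finner x x))) T"
      unfolding nonstandard_frame_def by blast
    show False
    proof (rule no_pointwise_frame[OF xs c1])
      fix x t assume x: "x \<in> C0 K" and t: "t \<in> A"
      obtain T where T: "T \<in> enveloping_vN (C0_unitization K)"
        "ultraweak_tendsto (C0_unitization K)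
          (\<lambda>F. univ_rep (C0_unitization K) (frame_sum finner xs x F)) T (finite_subsets_at_top J)"
        "univ_op_le (C0_unitization K)
          (univ_rep (C0_unitization K) (fscale (of_real c1) (finner x x))) T"
        using frame x by blast
      have "t \<in> topspace K"
        using t openin_subset[OF openin] by blast
      with T(2,1,3) xs x show "\<exists>L. ((\<lambda>F. frame_sum finner xs x F t) \<longlongrightarrow> L) (finite_subsets_at_top J) \<and>
          L - of_real c1 * finner x x t \<in> \<real>\<^sub>\<ge>\<^sub>0"
        by (rule ultraweak_frame_lower_bound)
    qed
  qed
qed

end

section \<open>Topological sums with a summand of class IV\<close>

text \<open>An open neighbourhood of the point at infinity is the complement of a compact set; if it
  misses \<open>S\<close>, that compact set contains \<open>S\<close>.\<close>

lemma class_IV_sigma_compact_bound: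
  assumes "class_IV P" "sigma_compactin P S"
  shows "\<exists>D. compactin P D \<and> S \<subseteq> D"
proof -
  have "None \<in> Alexandroff_compactification P interior_of
      (topspace (Alexandroff_compactification P) - Some ` S)"
    using assms by (simp add: class_IV_def)
  then obtain U where U: "openin (Alexandroff_compactification P) U" "None \<in> U"
    "U \<subseteq> topspace (Alexandroff_compactification P) - Some ` S"
    by (auto simp: interior_of_def)
  then obtain C where C: "compactin P C" "U = insert None (Some ` (topspace P - C))"
    by (auto simp: openin_Alexandroff_compactification)
  have "S \<subseteq> topspace P"
    using assms(2) compactin_subset_topspace by (fastforce simp: sigma_compactin_def)
  then have "S \<subseteq> C"
    using C(2) U(3) by auto
  then show ?thesis
    using C(1) by blast
qed

text \<open>A compact space is \<sigma>-compact in itself, and its complement in itself has empty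
  interior.\<close>

lemma class_IV_not_compact:
  assumes "class_IV P"
  shows "\<not> compactin P (topspace P)"
proof
  assume "compactin P (topspace P)"
  then have "sigma_compactin P (topspace P)"
    unfolding sigma_compactin_def by (intro exI[of _ "\<lambda>_. topspace P"]) simp
  then have "P interior_of (topspace P - topspace P) \<noteq> {}"
    using assms unfolding class_IV_def by blast
  then show False
    by simp
qed

text \<open>On the whole sum \<open>snd\<close> need not map into \<open>P i\<close>; on the i-th
  summand it inverts the open embedding x to (i, x) and is therefore continuous.\<close>

lemma compactin_sum_topology_section:
  assumes "i \<in> I" "compactin (sum_topology P I) C" "C \<subseteq> {i} \<times> topspace (P i)"
  shows "compactin (P i) (snd ` C)"
proof -
  have "compactin (subtopology (sum_topology P I) ({i} \<times> topspace (P i))) C"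
    using assms by (simp add: compactin_subtopology)
  moreover have "continuous_map (subtopology (sum_topology P I) ({i} \<times> topspace (P i))) (P i) snd"
    unfolding continuous_map_def
  proof (intro conjI allI impI funcsetI)
    show "snd t \<in> topspace (P i)"
      if "t \<in> topspace (subtopology (sum_topology P I) ({i} \<times> topspace (P i)))" for t
      using that by auto
    fix U assume "openin (P i) U"
    then have U: "openin (sum_topology P I) ((\<lambda>x. (i, x)) ` U)"
      using open_map_component_injection[OF assms(1), of P] by (simp add: open_map_def)
    have "{t \<in> topspace (subtopology (sum_topology P I) ({i} \<times> topspace (P i))). snd t \<in> U} =
        ({i} \<times> topspace (P i)) \<inter> (\<lambda>x. (i, x)) ` U"
      using assms(1) by auto
    then show "openin (subtopology (sum_topology P I) ({i} \<times> topspace (P i)))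
        {t \<in> topspace (subtopology (sum_topology P I) ({i} \<times> topspace (P i))). snd t \<in> U}"
      using U by (simp add: openin_subtopology_Int2)
  qed
  ultimately show ?thesis
    by (rule image_compactin)
qed

lemma Hausdorff_space_sum_topology:
  assumes "\<And>i. i \<in> I \<Longrightarrow> Hausdorff_space (P i)"
  shows "Hausdorff_space (sum_topology P I)"
  unfolding Hausdorff_space_def
proof (intro allI impI, elim conjE)
  fix s t assume st: "s \<in> topspace (sum_topology P I)" "t \<in> topspace (sum_topology P I)" "s \<noteq> t"
  obtain i x where s: "s = (i, x)" "i \<in> I" "x \<in> topspace (P i)"
    using st(1) by auto
  obtain k y where t: "t = (k, y)" "k \<in> I" "y \<in> topspace (P k)"
    using st(2) by auto
  have op: "openin (sum_topology P I) ((\<lambda>x. (i, x)) ` U)" if "i \<in> I" "openin (P i) U" for i U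
    using open_map_component_injection[OF that(1), of P] that(2) by (simp add: open_map_def)
  show "\<exists>U V. openin (sum_topology P I) U \<and> openin (sum_topology P I) V \<and>
      s \<in> U \<and> t \<in> V \<and> disjnt U V"
  proof (cases "i = k")
    case False
    show ?thesis
      by (intro exI[of _ "(\<lambda>x. (i, x)) ` topspace (P i)"] exI[of _ "(\<lambda>x. (k, x)) ` topspace (P k)"]
          conjI op s(2) t(2) openin_topspace) (use s t False in \<open>auto simp: disjnt_def\<close>)
  next
    case True
    then obtain U V where UV: "openin (P i) U" "openin (P i) V" "x \<in> U" "y \<in> V" "disjnt U V"
      using assms[OF s(2)] s t st(3) unfolding Hausdorff_space_def by metis
    show ?thesis
      by (intro exI[of _ "(\<lambda>x. (i, x)) ` U"] exI[of _ "(\<lambda>x. (i, x)) ` V"]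
          conjI op s(2) UV(1,2)) (use s t True UV in \<open>auto simp: disjnt_def\<close>)
  qed
qed

text \<open>The compact sets are projected to \<open>P i\<close>, enclosed there in a compact set by
  the class hypothesis, and the enclosure is carried back by the continuous injection.\<close>

lemma sum_topology_class_IV:
  assumes "class_IV (P i)" "i \<in> I" "\<And>k. k \<in> I \<Longrightarrow> LCH_space (P k)"
  shows "sigma_precompact_clopen (sum_topology P I) ({i} \<times> topspace (P i))"
proof
  let ?K = "sum_topology P I" and ?A = "{i} \<times> topspace (P i)"
  show "LCH_space ?K"
    using assms(3)
    by (simp add: LCH_space_def locally_compact_space_sum_topology Hausdorff_space_sum_topology)
  have "{x. (k, x) \<in> ?A} = (if k = i then topspace (P k) else {})" for k
    by auto
  then show "openin ?K ?A" "closedin ?K ?A"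
    using assms(2) by (auto simp: openin_sum_topology closedin_sum_topology)
  show "\<not> compactin ?K ?A"
  proof
    assume "compactin ?K ?A"
    from compactin_sum_topology_section[OF assms(2) this]
    have "compactin (P i) (topspace (P i))"
      by simp
    then show False
      using class_IV_not_compact[OF assms(1)] by blast
  qed
  fix C :: "nat \<Rightarrow> _" assume C: "\<And>n. compactin ?K (C n)" "\<And>n. C n \<subseteq> ?A"
  have "compactin (P i) (snd ` C n)" for n
    using compactin_sum_topology_section[OF assms(2) C] .
  then have "sigma_compactin (P i) (\<Union>n. snd ` C n)"
    unfolding sigma_compactin_def by (intro exI[of _ "\<lambda>n. snd ` C n"]) simp
  then obtain D where D: "compactin (P i) D" "(\<Union>n. snd ` C n) \<subseteq> D"
    using class_IV_sigma_compact_bound[OF assms(1)] by blast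
  have "compactin ?K (Pair i ` D)"
    using D(1) continuous_map_component_injection[OF assms(2)] by (rule image_compactin)
  moreover have "Pair i ` D \<subseteq> ?A"
    using compactin_subset_topspace[OF D(1)] by auto
  moreover have "(\<Union>n. C n) \<subseteq> Pair i ` D"
  proof
    fix t assume "t \<in> (\<Union>n. C n)"
    then obtain n where n: "t \<in> C n"
      by blast
    then have "t = (i, snd t)"
      using C(2)[of n] by auto
    moreover have "snd t \<in> D"
      using D(2) n by blast
    ultimately show "t \<in> Pair i ` D"
      by blast
  qed
  ultimately show "\<exists>D. compactin ?K D \<and> D \<subseteq> ?A \<and> (\<Union>n. C n) \<subseteq> D"
    by blast
qed

theorem theorem3p3:
  fixes P :: "nat \<Rightarrow> 'a topology"
    and K :: "(nat \<times> 'a) topology"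
    and F :: "(nat \<times> 'a \<Rightarrow> complex) \<Rightarrow> (nat \<times> 'a \<Rightarrow> complex)"
  assumes "class_IV (P 1)"
    and "class_I (P 2) \<or> class_II (P 2) \<or> class_III (P 2)"
    and "K = sum_topology P {1, 2}"
    and "F = (\<lambda>x. indicator ({1} \<times> topspace (P 1)) * x)"
  shows "adjointable (C0 K) finner (C0 K) finner F \<and>
    \<not> module_compact (C0 K) (C0 K) F \<and>
    Cb_C0_totally_bounded K (F ` {x \<in> C0 K. fnorm x \<le> 1}) \<and>
    \<not> (\<exists>(J :: 'j set) xs. standard_frame (C0_unitization K) (C0 K) finner J xs \<or>
                          nonstandard_frame (C0_unitization K) (C0 K) finner J xs)"
proof -
  have "LCH_space (P k)" if "k \<in> {1, 2}" for k
    using that assms(1,2)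
    by (auto simp: class_I_def class_II_def class_III_def class_IV_def)
  then interpret sigma_precompact_clopen K "{1} \<times> topspace (P 1)"
    unfolding assms(3) using assms(1) by (intro sum_topology_class_IV) auto
  show ?thesis
    unfolding assms(4)
    by (intro conjI adjointable_indicator not_module_compact_indicator
        totally_bounded_indicator_image) (simp only: no_frame not_ex simp_thms)
qed

end
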